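(* Let $\Gamma$ be a regular (weighted) potential game with mixed-strategy space $X\subset\mathbb{R}^\kappa$, and let $NE\subset X$ be its set of Nash equilibria. Then for Lebesgue-almost every initial condition $x_0\in X$, every solution $\mathbf{x}$ of the best-response dynamics $\dot{\mathbf{x}}\in\mathrm{BR}(\mathbf{x})-\mathbf{x}$ with $\mathbf{x}(0)=x_0$ converges to $NE$ at an exponential rate, i.e. there are constants $c,\lambda>0$ such that $d(\mathbf{x}(t),NE)\le c\,e^{-\lambda t}$ for all $t\ge 0$.
   Context: Games. A finite normal-form game $\Gamma$ has $N\ge 2$ players; player $i$ has a finite action set $Y_i=\{y_i^1,\dots,y_i^{K_i}\}$ and a utility $u_i:Y\to\mathbb{R}$, where $Y=\prod_j Y_j$. $\Gamma$ is a (weighted) potential game if there are a function $u:Y\to\mathbb{R}$ and weights $w_1,\dots,w_N>0$ with $u_i(y_i',y_{-i})-u_i(y_i'',y_{-i})=w_i\big(u(y_i',y_{-i})-u(y_i'',y_{-i})\big)$ for all $i$, $y_i',y_i''\in Y_i$ and $y_{-i}\in\prod_{j\ne i}Y_j$. Strategy space. $X_i=\{x_i\in\mathbb{R}^{K_i-1}: x_i^k\ge 0 \text{ for all } k,\ \sum_{k=1}^{K_i-1} x_i^k\le 1\}$, $X=\prod_i X_i\subset\mathbb{R}^\kappa$, $\kappa=\sum_i(K_i-1)$. The point $x_i$ represents the probability distribution $T_i(x_i)$ on $Y_i$ giving mass $1-\sum_{k} x_i^k$ to $y_i^1$ and mass $x_i^k$ to $y_i^{k+1}$. $U(x)$ denotes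 the expected value of $u$ when the players randomize independently according to $T_1(x_1),\dots,T_N(x_N)$; it is a polynomial in $x$, affine in each $x_i$ separately. $\mathrm{BR}_i(x_{-i})=\arg\max_{x_i'\in X_i}U(x_i',x_{-i})$ (equivalently, the maximizers of player $i$'s expected utility) and $\mathrm{BR}(x)=\prod_i\mathrm{BR}_i(x_{-i})$. A Nash equilibrium is an $x^*\in X$ with $x^*\in\mathrm{BR}(x^* )$. $d$ is Euclidean distance. Solutions. A solution with initial condition $x_0$ is an absolutely continuous $\mathbf{x}:[0,\infty)\to X$ with $\mathbf{x}(0)=x_0$ and $\dot{\mathbf{x}}(t)\in\mathrm{BR}(\mathbf{x}(t))-\mathbf{x}(t)$ for almost every $t$. Regularity. For an equilibrium $x^*$, let $C_i\subseteq Y_i$ be the support of $T_i(x_i^* )$, $\gamma_i=|C_i|$, and relabel the actions so that $C_i=\{y_i^1,\dots,y_i^{\gamma_i}\}$ (defining the coordinates of $X$ via this labeling). $x^*$ is first-order non-degenerate if $\frac{\partial U}{\partial x_i^k}(x^* )\neq 0$ for all $i$ and all $k=\gamma_i,\dots,K_i-1$. $x^*$ is second-order non-degenerate if the matrix $\Big(\frac{\partial^2U}{\partial x_i^k\partial x_j^\ell}(x^* )\Big)$, indexed by pairs $(i,k),(j,\ell)$ with $\gamma_i,\gamma_j\ge 2$, $1\le k\le\gamma_i-1$, $1\le\ell\le\gamma_j-1$, is invertible (vacuous if $x^*$ is pure). $x^*$ is regular if it is both first- and second-order non-degenerate. $\Gamma$ is regular if all its Nash equilibria are regular. *)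

theory Defs
  imports "HOL-Analysis.Analysis"
begin

text \<open>
  Players are the elements of a finite type \<open>'p\<close>; player \<open>i\<close> has the nonempty action set
  \<open>Y i\<close> inside a finite type \<open>'a\<close>, so the players may have different numbers of actions.
  The parameter \<open>b\<close> names the first action \<open>b i = y\<^sub>i\<^sup>1\<close> of each player. The coordinate
  \<open>x\<^sub>i\<^sup>k\<close>, which is the mass put on \<open>y\<^sub>i\<^sup>k\<^sup>+\<^sup>1\<close>, is indexed by the pair consisting of \<open>i\<close> and that
  action: only the choice of \<open>y\<^sub>i\<^sup>1\<close>, not the order of the others, affects the coordinate system
  (up to a permutation of coordinates). A point of \<open>\<real>\<^sup>\<kappa>\<close> is an extensional function on
  \<open>coords Y b\<close>; the case \<open>\<kappa> = 0\<close> is included.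
\<close>

type_synonym ('p, 'a) point = "'p \<times> 'a \<Rightarrow> real"

definition action_profiles :: "('p \<Rightarrow> 'a set) \<Rightarrow> ('p \<Rightarrow> 'a) set" where
  "action_profiles Y = PiE UNIV Y"

definition weighted_potential ::
  "('p \<Rightarrow> 'a set) \<Rightarrow> ('p \<Rightarrow> ('p \<Rightarrow> 'a) \<Rightarrow> real) \<Rightarrow> ('p \<Rightarrow> real) \<Rightarrow> (('p \<Rightarrow> 'a) \<Rightarrow> real) \<Rightarrow> bool" where
  "weighted_potential Y util w u \<longleftrightarrow>
     (\<forall>i. w i > 0) \<and>
     (\<forall>i. \<forall>y \<in> action_profiles Y. \<forall>a' \<in> Y i. \<forall>a'' \<in> Y i.
        util i (y(i := a')) - util i (y(i := a'')) = w i * (u (y(i := a')) - u (y(i := a''))))"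

definition coords :: "('p \<Rightarrow> 'a set) \<Rightarrow> ('p \<Rightarrow> 'a) \<Rightarrow> ('p \<times> 'a) set" where
  "coords Y b = (SIGMA i:UNIV. Y i - {b i})"

text \<open>The set \<open>X\<^sub>i\<close>, and the component \<open>x\<^sub>i\<close> of a point.\<close>

definition player_strategies :: "('p \<Rightarrow> 'a set) \<Rightarrow> ('p \<Rightarrow> 'a) \<Rightarrow> 'p \<Rightarrow> ('a \<Rightarrow> real) set" where
  "player_strategies Y b i =
     {f \<in> extensional (Y i - {b i}). (\<forall>a \<in> Y i - {b i}. 0 \<le> f a) \<and> (\<Sum>a \<in> Y i - {b i}. f a) \<le> 1}"

definition component :: "('p \<Rightarrow> 'a set) \<Rightarrow> ('p \<Rightarrow> 'a) \<Rightarrow> 'p \<Rightarrow> ('p, 'a) point \<Rightarrow> 'a \<Rightarrow> real" where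
  "component Y b i x = restrict (\<lambda>a. x (i, a)) (Y i - {b i})"

definition strategy_space :: "('p \<Rightarrow> 'a set) \<Rightarrow> ('p \<Rightarrow> 'a) \<Rightarrow> ('p, 'a) point set" where
  "strategy_space Y b =
     {x \<in> extensional (coords Y b). \<forall>i. component Y b i x \<in> player_strategies Y b i}"

text \<open>\<open>mass Y b x i\<close> is \<open>T\<^sub>i(x\<^sub>i)\<close>; it is defined for all points, so that \<open>mixed_ext Y b u\<close>, the
  multilinear extension \<open>U\<close> of \<open>u\<close>, is a polynomial on the whole of \<open>\<real>\<^sup>\<kappa>\<close>.\<close>

definition mass :: "('p \<Rightarrow> 'a set) \<Rightarrow> ('p \<Rightarrow> 'a) \<Rightarrow> ('p, 'a) point \<Rightarrow> 'p \<Rightarrow> 'a \<Rightarrow> real" where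
  "mass Y b x i a = (if a = b i then 1 - (\<Sum>a' \<in> Y i - {b i}. x (i, a')) else x (i, a))"

definition mixed_ext ::
  "('p::finite \<Rightarrow> 'a set) \<Rightarrow> ('p \<Rightarrow> 'a) \<Rightarrow> (('p \<Rightarrow> 'a) \<Rightarrow> real) \<Rightarrow> ('p, 'a) point \<Rightarrow> real" where
  "mixed_ext Y b u x = (\<Sum>y \<in> action_profiles Y. u y * (\<Prod>i\<in>UNIV. mass Y b x i (y i)))"

text \<open>\<open>replace_component x i f\<close> is the point \<open>(f, x\<^sub>-\<^sub>i)\<close>.\<close>

definition replace_component :: "('p, 'a) point \<Rightarrow> 'p \<Rightarrow> ('a \<Rightarrow> real) \<Rightarrow> ('p, 'a) point" where
  "replace_component x i f = (\<lambda>(j, a). if j = i then f a else x (j, a))"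

definition best_replies ::
  "('p::finite \<Rightarrow> 'a set) \<Rightarrow> ('p \<Rightarrow> 'a) \<Rightarrow> (('p \<Rightarrow> 'a) \<Rightarrow> real) \<Rightarrow> 'p \<Rightarrow> ('p, 'a) point \<Rightarrow> ('a \<Rightarrow> real) set"
  where
  "best_replies Y b u i x =
     {f. is_arg_max (\<lambda>g. mixed_ext Y b u (replace_component x i g)) (\<lambda>g. g \<in> player_strategies Y b i) f}"

definition BR ::
  "('p::finite \<Rightarrow> 'a set) \<Rightarrow> ('p \<Rightarrow> 'a) \<Rightarrow> (('p \<Rightarrow> 'a) \<Rightarrow> real) \<Rightarrow> ('p, 'a) point \<Rightarrow> ('p, 'a) point set" where
  "BR Y b u x = {z \<in> extensional (coords Y b). \<forall>i. component Y b i z \<in> best_replies Y b u i x}"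

definition NE ::
  "('p::finite \<Rightarrow> 'a set) \<Rightarrow> ('p \<Rightarrow> 'a) \<Rightarrow> (('p \<Rightarrow> 'a) \<Rightarrow> real) \<Rightarrow> ('p, 'a) point set" where
  "NE Y b u = {x \<in> strategy_space Y b. x \<in> BR Y b u x}"

text \<open>The best replies of player \<open>i\<close> with respect to the potential are those with respect to the
  utility function of player \<open>i\<close>.\<close>

lemma sum_mass:
  fixes Y :: "'p \<Rightarrow> 'a::finite set"
  assumes "b i \<in> Y i"
  shows "(\<Sum>a\<in>Y i. mass Y b x i a) = 1"
proof -
  have "(\<Sum>a\<in>Y i. mass Y b x i a) = mass Y b x i (b i) + (\<Sum>a\<in>Y i - {b i}. mass Y b x i a)"
    using assms by (simp add: sum.remove)
  also have "(\<Sum>a\<in>Y i - {b i}. mass Y b x i a) = (\<Sum>a\<in>Y i - {b i}. x (i, a))"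
    by (intro sum.cong) (auto simp: mass_def)
  finally show ?thesis by (simp add: mass_def)
qed

lemma mixed_ext_indifferent:
  fixes Y :: "'p::finite \<Rightarrow> 'a::finite set"
  assumes b: "b i \<in> Y i"
    and g: "\<And>y a a'. y \<in> action_profiles Y \<Longrightarrow> a \<in> Y i \<Longrightarrow> a' \<in> Y i \<Longrightarrow> g (y(i := a)) = g (y(i := a'))"
  shows "mixed_ext Y b g (replace_component x i f) = mixed_ext Y b g (replace_component x i f')"
proof -
  have eq: "mixed_ext Y b g (replace_component x i f) =
      (\<Sum>y\<in>PiE (UNIV - {i}) Y. g (y(i := b i)) * (\<Prod>j\<in>UNIV - {i}. mass Y b x j (y j)))" for f
  proof -
    let ?z = "replace_component x i f"
    let ?P = "PiE (UNIV - {i}) Y"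
    have zj: "mass Y b ?z j a = mass Y b x j a" if "j \<noteq> i" for j a
      using that by (simp add: mass_def replace_component_def)
    have prof: "action_profiles Y = (\<lambda>(a, y). y(i := a)) ` (Y i \<times> ?P)"
      unfolding action_profiles_def using PiE_insert_eq[of i "UNIV - {i}" Y] by (simp add: insert_UNIV)
    have inj: "inj_on (\<lambda>(a, y). y(i := a)) (Y i \<times> ?P)"
      using inj_combinator[of i "UNIV - {i}" Y] by simp
    have "mixed_ext Y b g ?z =
        (\<Sum>(a, y)\<in>Y i \<times> ?P. g (y(i := a)) * (\<Prod>j\<in>UNIV. mass Y b ?z j ((y(i := a)) j)))"
      unfolding mixed_ext_def prof by (subst sum.reindex[OF inj]) (simp add: case_prod_beta o_def)
    also have "\<dots> = (\<Sum>(a, y)\<in>Y i \<times> ?P.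
        g (y(i := b i)) * (\<Prod>j\<in>UNIV - {i}. mass Y b x j (y j)) * mass Y b ?z i a)"
    proof (intro sum.cong refl, clarify)
      fix a y assume a: "a \<in> Y i" and y: "y \<in> ?P"
      have "y(i := a) \<in> action_profiles Y"
        unfolding prof using a y by force
      from g[OF this a b] have "g (y(i := a)) = g (y(i := b i))" by simp
      moreover have "(\<Prod>j\<in>UNIV. mass Y b ?z j ((y(i := a)) j)) =
          mass Y b ?z i a * (\<Prod>j\<in>UNIV - {i}. mass Y b x j (y j))"
        by (subst prod.remove[of _ i]) (auto simp: zj intro!: prod.cong)
      ultimately show "g (y(i := a)) * (\<Prod>j\<in>UNIV. mass Y b ?z j ((y(i := a)) j)) =
          g (y(i := b i)) * (\<Prod>j\<in>UNIV - {i}. mass Y b x j (y j)) * mass Y b ?z i a"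
        by (simp add: mult_ac)
    qed
    also have "\<dots> = (\<Sum>y\<in>?P. \<Sum>a\<in>Y i.
        g (y(i := b i)) * (\<Prod>j\<in>UNIV - {i}. mass Y b x j (y j)) * mass Y b ?z i a)"
      by (subst sum.cartesian_product[symmetric], subst sum.swap) simp
    also have "\<dots> = (\<Sum>y\<in>?P. g (y(i := b i)) * (\<Prod>j\<in>UNIV - {i}. mass Y b x j (y j)))"
      by (simp add: sum_distrib_left[symmetric] sum_mass[where Y = Y and b = b and i = i, OF b])
    finally show ?thesis .
  qed
  show ?thesis by (simp only: eq)
qed

lemma best_replies_utility:
  fixes Y :: "'p::finite \<Rightarrow> 'a::finite set"
  assumes pot: "weighted_potential Y util w u" and b: "b i \<in> Y i"
  shows "best_replies Y b (util i) i x = best_replies Y b u i x"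
proof -
  let ?U = "\<lambda>v f. mixed_ext Y b v (replace_component x i f)"
  let ?g = "\<lambda>y. util i y - w i * u y"
  have w: "w i > 0" using pot by (simp add: weighted_potential_def)
  have lin: "?U ?g f = ?U (util i) f - w i * ?U u f" for f
    by (simp add: mixed_ext_def sum_subtractf sum_distrib_left algebra_simps)
  have same: "?U ?g f = ?U ?g f'" for f f'
  proof (rule mixed_ext_indifferent)
    show "b i \<in> Y i" by (fact b)
  next
    fix y a a' assume "y \<in> action_profiles Y" "a \<in> Y i" "a' \<in> Y i"
    then have "util i (y(i := a)) - util i (y(i := a')) = w i * (u (y(i := a)) - u (y(i := a')))"
      using pot unfolding weighted_potential_def by blast
    then show "?g (y(i := a)) = ?g (y(i := a'))"
      unfolding right_diff_distrib by linarith
  qed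
  have diff: "?U (util i) f - ?U (util i) f' = w i * (?U u f - ?U u f')" for f f'
    using same[of f f'] lin[of f] lin[of f'] unfolding right_diff_distrib by linarith
  have "?U (util i) f' < ?U (util i) f \<longleftrightarrow> ?U u f' < ?U u f" for f f'
    using diff[of f f'] zero_less_mult_iff[of "w i" "?U u f - ?U u f'"] w by linarith
  then show ?thesis by (simp add: best_replies_def is_arg_max_def)
qed

text \<open>Regularity. Relabelling the actions so that the support comes first amounts to changing to
  a coordinate system whose base actions \<open>b'\<close> lie in the support; \<open>change_base Y b b' x\<close>
  is the same mixed profile in these coordinates. Nothing depends on which \<open>b'\<close> in the
  support is used.\<close>

definition supp :: "('p \<Rightarrow> 'a set) \<Rightarrow> ('p \<Rightarrow> 'a) \<Rightarrow> ('p, 'a) point \<Rightarrow> 'p \<Rightarrow> 'a set" where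
  "supp Y b x i = {a \<in> Y i. mass Y b x i a > 0}"

definition change_base ::
  "('p \<Rightarrow> 'a set) \<Rightarrow> ('p \<Rightarrow> 'a) \<Rightarrow> ('p \<Rightarrow> 'a) \<Rightarrow> ('p, 'a) point \<Rightarrow> ('p, 'a) point" where
  "change_base Y b b' x = restrict (\<lambda>(i, a). mass Y b x i a) (coords Y b')"

definition partial :: "('c \<Rightarrow> real) \<Rightarrow> (('c \<Rightarrow> real) \<Rightarrow> real) \<Rightarrow> 'c \<Rightarrow> real" where
  "partial x F c = deriv (\<lambda>s. F (x(c := s))) (x c)"

definition partial2 :: "('c \<Rightarrow> real) \<Rightarrow> (('c \<Rightarrow> real) \<Rightarrow> real) \<Rightarrow> 'c \<Rightarrow> 'c \<Rightarrow> real" where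
  "partial2 x F c d = partial x (\<lambda>z. partial z F d) c"

definition invertible_matrix_on :: "'c set \<Rightarrow> ('c \<Rightarrow> 'c \<Rightarrow> real) \<Rightarrow> bool" where
  "invertible_matrix_on J A \<longleftrightarrow>
     (\<exists>B. \<forall>c\<in>J. \<forall>d\<in>J. (\<Sum>e\<in>J. A c e * B e d) = (if c = d then 1 else 0) \<and>
                      (\<Sum>e\<in>J. B c e * A e d) = (if c = d then 1 else 0))"

definition first_order_nondegenerate ::
  "('p::finite \<Rightarrow> 'a set) \<Rightarrow> ('p \<Rightarrow> 'a) \<Rightarrow> (('p \<Rightarrow> 'a) \<Rightarrow> real) \<Rightarrow> ('p, 'a) point \<Rightarrow> bool" where
  "first_order_nondegenerate Y b u x \<longleftrightarrow>
     (\<exists>b'. (\<forall>i. b' i \<in> supp Y b x i) \<and>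
        (\<forall>i. \<forall>a \<in> Y i - supp Y b x i.
           partial (change_base Y b b' x) (mixed_ext Y b' u) (i, a) \<noteq> 0))"

definition second_order_nondegenerate ::
  "('p::finite \<Rightarrow> 'a set) \<Rightarrow> ('p \<Rightarrow> 'a) \<Rightarrow> (('p \<Rightarrow> 'a) \<Rightarrow> real) \<Rightarrow> ('p, 'a) point \<Rightarrow> bool" where
  "second_order_nondegenerate Y b u x \<longleftrightarrow>
     (\<exists>b'. (\<forall>i. b' i \<in> supp Y b x i) \<and>
        invertible_matrix_on (SIGMA i:UNIV. supp Y b x i - {b' i})
          (partial2 (change_base Y b b' x) (mixed_ext Y b' u)))"

definition regular_game ::
  "('p::finite \<Rightarrow> 'a set) \<Rightarrow> ('p \<Rightarrow> 'a) \<Rightarrow> (('p \<Rightarrow> 'a) \<Rightarrow> real) \<Rightarrow> bool" where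
  "regular_game Y b u \<longleftrightarrow>
     (\<forall>x \<in> NE Y b u. first_order_nondegenerate Y b u x \<and> second_order_nondegenerate Y b u x)"

text \<open>Solutions. On the unbounded interval \<open>[0,\<infinity>)\<close>, absolute continuity is understood on compact
  subintervals; since \<open>BR(x) - x\<close> is bounded, for solutions this agrees with the global notion.
  In finite dimension, absolute continuity and differentiability may be taken coordinatewise.\<close>

definition absolutely_continuous_on :: "real set \<Rightarrow> (real \<Rightarrow> 'b::metric_space) \<Rightarrow> bool" where
  "absolutely_continuous_on S f \<longleftrightarrow>
     (\<forall>\<epsilon>>0. \<exists>\<delta>>0. \<forall>(n::nat) l r.
        (\<forall>k<n. l k \<le> r k \<and> {l k..r k} \<subseteq> S) \<and>
        disjoint_family_on (\<lambda>k. {l k<..<r k}) {..<n} \<and>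
        (\<Sum>k<n. r k - l k) < \<delta>
        \<longrightarrow> (\<Sum>k<n. dist (f (l k)) (f (r k))) < \<epsilon>)"

definition solution ::
  "('p::finite \<Rightarrow> 'a set) \<Rightarrow> ('p \<Rightarrow> 'a) \<Rightarrow> (('p \<Rightarrow> 'a) \<Rightarrow> real) \<Rightarrow> ('p, 'a) point \<Rightarrow>
    (real \<Rightarrow> ('p, 'a) point) \<Rightarrow> bool" where
  "solution Y b u x0 x \<longleftrightarrow>
     (\<forall>t\<ge>0. x t \<in> strategy_space Y b) \<and>
     (\<forall>c \<in> coords Y b. \<forall>T\<ge>0. absolutely_continuous_on {0..T} (\<lambda>t. x t c)) \<and>
     x 0 = x0 \<and>
     (AE t in lborel. 0 \<le> t \<longrightarrow>
        (\<exists>z \<in> BR Y b u (x t). \<forall>c \<in> coords Y b.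
           ((\<lambda>s. x s c) has_real_derivative (z c - x t c)) (at t within {0..})))"

definition distance_to ::
  "('p \<Rightarrow> 'a set) \<Rightarrow> ('p \<Rightarrow> 'a) \<Rightarrow> ('p, 'a) point \<Rightarrow> ('p, 'a) point set \<Rightarrow> real" where
  "distance_to Y b x A = (INF z\<in>A. L2_set (\<lambda>c. x c - z c) (coords Y b))"

end

theory Submission
  imports Defs
begin

text \<open>
  In mass coordinates let the regret of a profile
  be the total of the terms \<open>m\<^sub>i(a) (P\<^sub>i(a') - P\<^sub>i(a))\<^sup>+\<close>, where \<open>P\<^sub>i(a)\<close> is the expected value of the
  potential when player \<open>i\<close> plays \<open>a\<close>. It vanishes exactly at the equilibria, and the potential
  grows along solutions at a rate bounded below by a multiple of it. Regularity and the inverse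
  function argument give \<open>d(x, NE) \<le> K regret(x)\<close> near each equilibrium, and compactness then
  everywhere; in particular there are finitely many equilibria. Let \<open>\<delta> = d(x(t), NE)\<close> and let \<open>g\<close> be
  the gap between the potential and its limit. As solutions have bounded speed, \<open>\<delta>\<^sup>2\<close> is at most a
  multiple of \<open>g\<close>, so \<open>\<delta> \<rightarrow> 0\<close>; since the potential takes finitely many values on the
  equilibria, eventually \<open>g \<le> L \<delta>\<close>. Hence \<open>g' \<le> - k \<delta> \<le> - (k / L) g\<close>, so \<open>g\<close> and with it \<open>\<delta>\<close>
  decay exponentially.
\<close>

subsection \<open>Absolutely continuous functions with nonnegative derivative\<close>

lemma absolutely_continuous_onE:
  assumes "absolutely_continuous_on S f" and "\<epsilon> > 0"
  obtains \<delta> where "\<delta> > 0" and "\<And>(n::nat) l r. (\<forall>k<n. l k \<le> r k \<and> {l k..r k} \<subseteq> S) \<Longrightarrow>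
      disjoint_family_on (\<lambda>k. {l k<..<r k}) {..<n} \<Longrightarrow> (\<Sum>k<n. r k - l k) < \<delta> \<Longrightarrow>
      (\<Sum>k<n. dist (f (l k)) (f (r k))) < \<epsilon>"
proof -
  from assms(1)[unfolded absolutely_continuous_on_def, rule_format, OF assms(2)]
  show ?thesis by (elim exE conjE) (rule that, assumption, simp)
qed

text \<open>A gauge for the indicator function of the exceptional null set bounds the total length of
  the intervals tagged there, hence by absolute continuity their contribution to \<open>f b - f a\<close>.\<close>

lemma absolutely_continuous_nondecreasing:
  fixes f :: "real \<Rightarrow> real"
  assumes ab: "a \<le> b" and ac: "absolutely_continuous_on {a..b} f"
    and ae: "AE t in lborel. t \<in> {a..b} \<longrightarrow> (\<exists>d\<ge>0. (f has_real_derivative d) (at t within {a..b}))"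
  shows "f a \<le> f b"
proof -
  define N where "N = {t \<in> {a..b}. \<not> (\<exists>d\<ge>0. (f has_real_derivative d) (at t within {a..b}))}"
  obtain M where M: "{t. \<not> (t \<in> {a..b} \<longrightarrow> (\<exists>d\<ge>0. (f has_real_derivative d) (at t within {a..b})))} \<subseteq> M"
      "M \<in> null_sets lborel"
    using ae unfolding eventually_ae_filter by auto
  have "negligible M"
    using M(2) by (simp add: negligible_iff_null_sets null_sets_completionI)
  then have "negligible N"
    by (rule negligible_subset) (use M(1) in \<open>auto simp: N_def\<close>)
  then have int: "(indicat_real N has_integral 0) {a..b}"
    by (simp add: negligible)
  have main: "f b - f a \<ge> - e * (b - a) - e" if e: "e > 0" for e
  proof -
    obtain \<delta> where \<delta>: "\<delta> > 0" and ac\<delta>: "\<And>(n::nat) l r. (\<forall>k<n. l k \<le> r k \<and> {l k..r k} \<subseteq> {a..b}) \<Longrightarrow>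
        disjoint_family_on (\<lambda>k. {l k<..<r k}) {..<n} \<Longrightarrow> (\<Sum>k<n. r k - l k) < \<delta> \<Longrightarrow>
        (\<Sum>k<n. dist (f (l k)) (f (r k))) < e"
      by (rule absolutely_continuous_onE[OF ac e]) blast
    obtain \<gamma> where \<gamma>: "gauge \<gamma>" and \<gamma>N: "\<And>\<D>. \<D> tagged_division_of {a..b} \<Longrightarrow> \<gamma> fine \<D> \<Longrightarrow>
        norm ((\<Sum>(x,k)\<in>\<D>. measure lborel k *\<^sub>R indicat_real N x) - 0) < \<delta>"
    proof -
      obtain \<gamma> where "gauge \<gamma> \<and> (\<forall>\<D>. \<D> tagged_division_of {a..b} \<and> \<gamma> fine \<D> \<longrightarrow>
          norm ((\<Sum>(x,k)\<in>\<D>. measure lborel k *\<^sub>R indicat_real N x) - 0) < \<delta>)"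
        using has_integral_real[THEN iffD1, OF int, rule_format, OF \<delta>] by (rule exE)
      then show ?thesis by (intro that[of \<gamma>]) simp_all
    qed
    \<comment> \<open>Straddle estimate: adding the linear approximations on both sides of the tag
      \<open>t\<close> shows that every short interval around \<open>t\<close> has an increment of
      at least \<open>- e\<close> times its length, since the derivative there is
      nonnegative.\<close>
    have "\<exists>\<eta>>0. \<forall>l r. l \<le> t \<and> t \<le> r \<and> a \<le> l \<and> r \<le> b \<and> {l..r} \<subseteq> ball t \<eta> \<longrightarrow> f r - f l \<ge> - e * (r - l)"
      if t: "t \<in> {a..b} - N" for t
    proof -
      obtain d where d: "d \<ge> 0" "(f has_real_derivative d) (at t within {a..b})"
        using t unfolding N_def by blast
      then obtain \<eta> where \<eta>: "\<eta> > 0"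
        "\<And>s. s \<in> {a..b} \<Longrightarrow> norm (s - t) < \<eta> \<Longrightarrow> norm (f s - f t - d * (s - t)) \<le> e * norm (s - t)"
        using e unfolding has_field_derivative_def has_derivative_within_alt by (force simp: mult.commute)
      have "f r - f l \<ge> - e * (r - l)"
        if "l \<le> t" "t \<le> r" "a \<le> l" "r \<le> b" "{l..r} \<subseteq> ball t \<eta>" for l r
      proof -
        have "l \<in> {l..r}" "r \<in> {l..r}" using that by auto
        then have "l \<in> ball t \<eta>" "r \<in> ball t \<eta>" using that(5) by blast+
        then have "norm (f r - f t - d * (r - t)) \<le> e * norm (r - t)"
          "norm (f l - f t - d * (l - t)) \<le> e * norm (l - t)"
          using \<eta>(2)[of r] \<eta>(2)[of l] that by (auto simp: dist_real_def)
        then have "f r - f t \<ge> d * (r - t) - e * (r - t)" "f l - f t \<le> d * (l - t) + e * (t - l)"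
          using that by (auto simp: abs_le_iff)
        moreover have "d * (r - t) \<ge> 0" "d * (l - t) \<le> 0"
          using that d by (auto simp: mult_nonneg_nonpos)
        ultimately show ?thesis by (simp add: algebra_simps)
      qed
      then show ?thesis using \<eta>(1) by blast
    qed
    then obtain \<eta> where \<eta>: "\<And>t. t \<in> {a..b} - N \<Longrightarrow> \<eta> t > 0"
      "\<And>t l r. t \<in> {a..b} - N \<Longrightarrow> l \<le> t \<Longrightarrow> t \<le> r \<Longrightarrow> a \<le> l \<Longrightarrow> r \<le> b \<Longrightarrow> {l..r} \<subseteq> ball t (\<eta> t)
        \<Longrightarrow> f r - f l \<ge> - e * (r - l)"
      by metis
    \<comment> \<open>\<open>\<gamma>\<close> controls the tags in \<open>N\<close> and
      \<open>\<eta>\<close> the tags outside it. The radius 1 on \<open>N\<close> is arbitrary; it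
      only makes the second factor a gauge.\<close>
    define \<rho> where "\<rho> t = \<gamma> t \<inter> ball t (if t \<in> {a..b} - N then \<eta> t else 1)" for t
    have "gauge (\<lambda>t. ball t (if t \<in> {a..b} - N then \<eta> t else 1))"
      using \<eta>(1) by (intro gauge_ball_dependent) auto
    then have "gauge \<rho>"
      unfolding \<rho>_def by (rule gauge_Int[OF \<gamma>])
    then obtain p where p: "p tagged_division_of {a..b}" and fine: "\<rho> fine p"
      by (rule fine_division_exists_real)
    have fin: "finite p" by (rule tagged_division_ofD(1)[OF p])
    have tag: "k = {Inf k..Sup k} \<and> Inf k \<le> x \<and> x \<le> Sup k \<and> a \<le> Inf k \<and> Sup k \<le> b \<and> measure lborel k = Sup k - Inf k"
      if xk: "(x, k) \<in> p" for x k
    proof -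
      obtain l r where k: "k = cbox l r" using tagged_division_ofD(4)[OF p xk] by blast
      have "x \<in> k" "k \<subseteq> {a..b}" using tagged_division_ofD(2,3)[OF p xk] .
      then show ?thesis by (auto simp: k)
    qed
    define B where "B = {z \<in> p. fst z \<in> N}"
    have finB: "finite B" using fin by (simp add: B_def)
    have good: "(\<Sum>(x,k)\<in>p - B. f (Sup k) - f (Inf k)) \<ge> (\<Sum>(x,k)\<in>p - B. - e * measure lborel k)"
    proof (rule sum_mono, clarify)
      fix x k assume xk: "(x, k) \<in> p" "(x, k) \<notin> B"
      have x: "x \<in> {a..b} - N"
        using xk tagged_division_ofD(2,3)[OF p xk(1)] by (auto simp: B_def)
      have "k \<subseteq> \<rho> x"
        using fine xk(1) by (rule fineD)
      then have "k \<subseteq> ball x (\<eta> x)"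
        using x by (simp add: \<rho>_def)
      with x show "f (Sup k) - f (Inf k) \<ge> - e * measure lborel k"
        using \<eta>(2)[of x "Inf k" "Sup k"] tag[OF xk(1)] by auto
    qed
    have "(\<Sum>(x,k)\<in>p - B. measure lborel k) \<le> (\<Sum>(x,k)\<in>p. measure lborel k)"
      using fin by (intro sum_mono2) auto
    also have "\<dots> = b - a"
      using additive_content_tagged_division[of p a b] p ab by simp
    finally have "e * (\<Sum>(x,k)\<in>p - B. measure lborel k) \<le> e * (b - a)"
      using e by simp
    then have good': "(\<Sum>(x,k)\<in>p - B. f (Sup k) - f (Inf k)) \<ge> - e * (b - a)"
      using good by (simp add: sum_negf case_prod_beta sum_distrib_left[symmetric])
    \<comment> \<open>Absolute continuity speaks of finite sequences of intervals, so the badly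
      tagged pairs are enumerated. Enumerating pairs rather than intervals is safe: distinct pairs
      of a tagged division have intervals with disjoint interiors.\<close>
    obtain h where h: "bij_betw h {..<card B} B"
      using ex_bij_betw_nat_finite[OF finB] by (auto simp: atLeast0LessThan)
    define l where "l j = Inf (snd (h j))" for j
    define r where "r j = Sup (snd (h j))" for j
    have hB: "h j \<in> p \<and> fst (h j) \<in> N" if "j < card B" for j
      using bij_betwE[OF h] that unfolding B_def by auto
    have lr: "snd (h j) = {l j..r j} \<and> l j \<le> r j \<and> {l j..r j} \<subseteq> {a..b} \<and> measure lborel (snd (h j)) = r j - l j"
      if "j < card B" for j
    proof -
      have "(fst (h j), snd (h j)) \<in> p" using hB[OF that] by simp
      from tag[OF this, folded l_def r_def] show ?thesis by simp
    qed
    have re: "(\<Sum>(x,k)\<in>B. F k) = (\<Sum>j<card B. F (snd (h j)))" for F :: "real set \<Rightarrow> real"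
      using sum.reindex_bij_betw[OF h, of "\<lambda>z. F (snd z)"] by (simp add: case_prod_beta)
    have disj: "disjoint_family_on (\<lambda>k. {l k<..<r k}) {..<card B}"
      unfolding disjoint_family_on_def
    proof (intro ballI impI)
      fix i j assume ij: "i \<in> {..<card B}" "j \<in> {..<card B}" "i \<noteq> j"
      have "h i \<noteq> h j"
        using h ij unfolding bij_betw_def inj_on_def by blast
      then have "interior (snd (h i)) \<inter> interior (snd (h j)) = {}"
        using tagged_division_ofD(5)[OF p, of "fst (h i)" "snd (h i)" "fst (h j)" "snd (h j)"]
          hB[of i] hB[of j] ij by (auto simp: prod_eq_iff)
      then show "{l i<..<r i} \<inter> {l j<..<r j} = {}"
        using lr[of i] lr[of j] ij by simp
    qed
    have "(\<Sum>j<card B. r j - l j) = (\<Sum>(x,k)\<in>B. measure lborel k)"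
      using re[of "measure lborel"] lr by simp
    also have "\<dots> = (\<Sum>(x,k)\<in>p. measure lborel k *\<^sub>R indicat_real N x)"
      unfolding B_def using fin by (intro sum.mono_neutral_cong_left) (auto simp: indicator_def split: if_splits)
    also have "\<dots> < \<delta>"
    proof -
      have "\<gamma> fine p" using fine by (auto simp: fine_def \<rho>_def)
      from \<gamma>N[OF p this] show ?thesis by (simp only: diff_0_right real_norm_def abs_less_iff)
    qed
    finally have "(\<Sum>j<card B. dist (f (l j)) (f (r j))) < e"
      using lr disj by (intro ac\<delta>) auto
    moreover have "\<bar>\<Sum>(x,k)\<in>B. f (Sup k) - f (Inf k)\<bar> \<le> (\<Sum>j<card B. dist (f (l j)) (f (r j)))"
      unfolding re[of "\<lambda>k. f (Sup k) - f (Inf k)"] l_def r_def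
      by (rule order_trans[OF sum_abs]) (simp add: dist_real_def abs_minus_commute)
    ultimately have "(\<Sum>(x,k)\<in>B. f (Sup k) - f (Inf k)) \<ge> - e" by linarith
    moreover have "f b - f a = (\<Sum>(x,k)\<in>p - B. f (Sup k) - f (Inf k)) + (\<Sum>(x,k)\<in>B. f (Sup k) - f (Inf k))"
      unfolding additive_tagged_division_1[OF ab p, symmetric]
      using fin by (intro sum.subset_diff) (auto simp: B_def)
    ultimately show ?thesis using good' by linarith
  qed
  show ?thesis
  proof (rule ccontr)
    assume "\<not> f a \<le> f b"
    then have "f a - f b > 0" by simp
    \<comment> \<open>With this \<open>e\<close>, \<open>main\<close> allows a drop of at most half
      of \<open>f a - f b\<close>. The summand 1 in the denominator accounts for the second error
      term and covers \<open>a = b\<close>.\<close>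
    define e where "e = (f a - f b) / (2 * (b - a + 1))"
    have "e > 0" "e * (b - a + 1) = (f a - f b) / 2"
      using \<open>f a - f b > 0\<close> ab by (auto simp: e_def field_simps)
    then show False using main[of e] \<open>f a - f b > 0\<close> by (simp add: algebra_simps)
  qed
qed

section \<open>Transfer of absolute continuity\<close>

lemma absolutely_continuous_on_subset:
  "absolutely_continuous_on S f \<Longrightarrow> T \<subseteq> S \<Longrightarrow> absolutely_continuous_on T f"
  unfolding absolutely_continuous_on_def by (meson subset_trans)

text \<open>The increments of \<open>g\<close> over a family of intervals are bounded by those of
  \<open>f\<close> plus \<open>K\<close> times the total length. This serves perturbations of
  \<open>f\<close> by an affine function and, with \<open>f\<close> constant, Lipschitz
  functions.\<close>

lemma absolutely_continuous_on_dist_le: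
  fixes f :: "real \<Rightarrow> 'b::metric_space" and g :: "real \<Rightarrow> 'c::metric_space"
  assumes "absolutely_continuous_on S f" and K: "K \<ge> 0"
    and le: "\<And>s t. s \<le> t \<Longrightarrow> {s..t} \<subseteq> S \<Longrightarrow> dist (g s) (g t) \<le> dist (f s) (f t) + K * (t - s)"
  shows "absolutely_continuous_on S g"
  unfolding absolutely_continuous_on_def
proof (intro allI impI)
  fix \<epsilon> :: real assume \<epsilon>: "\<epsilon> > 0"
  obtain \<delta> where \<delta>: "\<delta> > 0" and ac: "\<And>(n::nat) l r. (\<forall>k<n. l k \<le> r k \<and> {l k..r k} \<subseteq> S) \<Longrightarrow>
      disjoint_family_on (\<lambda>k. {l k<..<r k}) {..<n} \<Longrightarrow> (\<Sum>k<n. r k - l k) < \<delta> \<Longrightarrow>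
      (\<Sum>k<n. dist (f (l k)) (f (r k))) < \<epsilon> / 2"
    by (rule absolutely_continuous_onE[OF assms(1), of "\<epsilon> / 2"]) (use \<epsilon> in auto)
  \<comment> \<open>Each of the two contributions gets half of \<open>\<epsilon>\<close>; the
    denominator has \<open>K + 1\<close> so that \<open>K = 0\<close> is allowed.\<close>
  define \<delta>' where "\<delta>' = min \<delta> (\<epsilon> / (2 * (K + 1)))"
  have "\<delta>' > 0" using \<delta> \<epsilon> K by (simp add: \<delta>'_def)
  moreover have "(\<Sum>k<n. dist (g (l k)) (g (r k))) < \<epsilon>"
    if *: "\<forall>k<n. l k \<le> r k \<and> {l k..r k} \<subseteq> S" "disjoint_family_on (\<lambda>k. {l k<..<r k}) {..<n}"
      "(\<Sum>k<n. r k - l k) < \<delta>'" for n :: nat and l r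
  proof -
    have "(\<Sum>k<n. dist (g (l k)) (g (r k))) \<le> (\<Sum>k<n. dist (f (l k)) (f (r k)) + K * (r k - l k))"
      using * by (intro sum_mono le) auto
    also have "\<dots> = (\<Sum>k<n. dist (f (l k)) (f (r k))) + K * (\<Sum>k<n. r k - l k)"
      by (simp add: sum.distrib sum_distrib_left)
    also have "K * (\<Sum>k<n. r k - l k) \<le> K * (\<epsilon> / (2 * (K + 1)))"
      using * K by (intro mult_left_mono) (auto simp: \<delta>'_def)
    also have "K * (\<epsilon> / (2 * (K + 1))) \<le> \<epsilon> / 2"
      using K \<epsilon> by (simp add: field_simps)
    also have "(\<Sum>k<n. dist (f (l k)) (f (r k))) < \<epsilon> / 2"
      using * by (intro ac) (auto simp: \<delta>'_def)
    finally show ?thesis by simp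
  qed
  ultimately show "\<exists>\<delta>>0. \<forall>(n::nat) l r. (\<forall>k<n. l k \<le> r k \<and> {l k..r k} \<subseteq> S) \<and>
      disjoint_family_on (\<lambda>k. {l k<..<r k}) {..<n} \<and> (\<Sum>k<n. r k - l k) < \<delta> \<longrightarrow>
      (\<Sum>k<n. dist (g (l k)) (g (r k))) < \<epsilon>"
    by blast
qed

lemma absolutely_continuous_on_const: "absolutely_continuous_on S (\<lambda>_. c)"
  unfolding absolutely_continuous_on_def by (auto intro!: exI[of _ 1])

lemma Lipschitz_absolutely_continuous:
  assumes "K \<ge> 0" "\<And>s t. s \<le> t \<Longrightarrow> {s..t} \<subseteq> S \<Longrightarrow> dist (g s) (g t) \<le> K * (t - s)"
  shows "absolutely_continuous_on S g"
  by (rule absolutely_continuous_on_dist_le[OF absolutely_continuous_on_const[of S "0::real"] assms(1)])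
    (simp add: assms(2))

subsection \<open>Exponential approach to the equilibria\<close>

text \<open>Shrinking by the factor \<open>q\<close> per unit of time is decay at rate
  \<open>ln q\<close>; monotonicity fills in the times between the sample points
  \<open>T + n\<close>.\<close>

lemma geometric_decay_imp_exponential:
  fixes g :: "real \<Rightarrow> real"
  assumes decr: "\<And>s t. 0 \<le> s \<Longrightarrow> s \<le> t \<Longrightarrow> g t \<le> g s" and nonneg: "\<And>t. 0 \<le> t \<Longrightarrow> 0 \<le> g t"
    and T: "0 \<le> T" and q: "1 < q" and step: "\<And>s. T \<le> s \<Longrightarrow> q * g (s + 1) \<le> g s"
  obtains M where "M > 0" "\<And>t. 0 \<le> t \<Longrightarrow> g t \<le> M * exp (- ln q * t)"
proof
  \<comment> \<open>The factor with \<open>T + 1\<close> pays for the initial interval up to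
    \<open>T\<close> and for the fractional part of \<open>t - T\<close>; \<open>g 0 + 1\<close>
    keeps \<open>M\<close> positive if \<open>g 0 = 0\<close>.\<close>
  define M where "M = (g 0 + 1) * exp (ln q * (T + 1))"
  have g0: "0 \<le> g 0" by (rule nonneg) simp
  then show "M > 0" by (simp add: M_def add_nonneg_pos)
  have pow: "g (T + real n) \<le> g 0 * exp (- ln q * real n)" for n
  proof (induction n)
    case 0
    show ?case using decr[of 0 T] T by simp
  next
    case (Suc n)
    have "q * g (T + real (Suc n)) \<le> g (T + real n)"
      using step[of "T + real n"] by (simp add: algebra_simps)
    also note Suc
    finally have "g (T + real (Suc n)) \<le> g 0 * (exp (- ln q * real n) / q)"
      using q by (simp add: field_simps)
    also have "exp (- ln q * real n) / q = exp (- ln q * real (Suc n))"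
    proof -
      have "exp (- ln q * real (Suc n)) = exp (- ln q * real n) * exp (- ln q)"
        by (simp add: exp_add[symmetric] algebra_simps)
      then show ?thesis using q by (simp add: exp_minus divide_inverse)
    qed
    finally show ?case .
  qed
  show "g t \<le> M * exp (- ln q * t)" if t: "0 \<le> t" for t
  proof (cases "t \<le> T")
    case True
    have "g t \<le> g 0 * 1" using decr[of 0 t] t by simp
    also have "\<dots> \<le> (g 0 + 1) * exp (ln q * (T + 1 - t))"
      using g0 q True by (intro mult_mono) auto
    also have "\<dots> = M * exp (- ln q * t)"
      by (simp add: M_def exp_add[symmetric] algebra_simps)
    finally show ?thesis .
  next
    case False
    define n where "n = nat \<lfloor>t - T\<rfloor>"
    have n: "real n \<le> t - T" "t - T - 1 \<le> real n"
      using False by (auto simp: n_def)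
    have "g t \<le> g (T + real n)"
      using n T by (intro decr) auto
    also note pow
    also have "g 0 * exp (- ln q * real n) \<le> (g 0 + 1) * exp (ln q * (T + 1 - t))"
    proof (intro mult_mono)
      have "ln q * (t - T - 1) \<le> ln q * real n"
        using n q by (intro mult_left_mono) auto
      then show "exp (- ln q * real n) \<le> exp (ln q * (T + 1 - t))"
        by (simp add: algebra_simps)
    qed (use g0 in auto)
    also have "\<dots> = M * exp (- ln q * t)"
      by (simp add: M_def exp_add[symmetric] algebra_simps)
    finally show ?thesis .
  qed
qed

text \<open>The analytic core, free of games: a Lipschitz function \<open>U\<close> rises along a
  path of bounded speed at a rate of at least \<open>k\<close> times the distance to a finite set
  \<open>E\<close>. The resulting exponent is half of \<open>ln (1 + k / L)\<close>.\<close>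

lemma exponential_approach:
  fixes m :: "real \<Rightarrow> 'v::heine_borel" and U :: "'v \<Rightarrow> real"
  assumes E: "finite E" "E \<noteq> {}" "E \<subseteq> S" and mS: "\<And>t. 0 \<le> t \<Longrightarrow> m t \<in> S"
    and L: "L > 0" "\<And>v w. v \<in> S \<Longrightarrow> w \<in> S \<Longrightarrow> \<bar>U v - U w\<bar> \<le> L * dist v w"
    and D: "D > 0" "\<And>s t. 0 \<le> s \<Longrightarrow> 0 \<le> t \<Longrightarrow> dist (m s) (m t) \<le> D * \<bar>s - t\<bar>"
    and k: "k > 0"
    and ae: "AE t in lborel. 0 \<le> t \<longrightarrow>
      (\<exists>d. k * infdist (m t) E \<le> d \<and> ((\<lambda>s. U (m s)) has_real_derivative d) (at t within {0..}))"
    and bdd: "\<And>t. 0 \<le> t \<Longrightarrow> U (m t) \<le> B"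
  shows "\<exists>c>0. \<exists>l>0. \<forall>t\<ge>0. infdist (m t) E \<le> c * exp (- l * t)"
proof -
  define f where "f t = U (m t)" for t
  define \<delta> where "\<delta> t = infdist (m t) E" for t
  have \<delta>0: "0 \<le> \<delta> t" for t by (simp add: \<delta>_def infdist_nonneg)
  have f_Lip: "\<bar>f s - f t\<bar> \<le> L * D * \<bar>s - t\<bar>" if "0 \<le> s" "0 \<le> t" for s t
  proof -
    have "\<bar>f s - f t\<bar> \<le> L * dist (m s) (m t)"
      unfolding f_def using that mS by (intro L(2)) auto
    also have "\<dots> \<le> L * (D * \<bar>s - t\<bar>)"
      using L(1) D(2)[OF that] by (intro mult_left_mono) auto
    finally show ?thesis by (simp add: mult.assoc)
  qed
  \<comment> \<open>Integrated form of the growth condition: after subtracting the line of slope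
    \<open>k * \<phi>\<close> a Lipschitz function with almost everywhere nonnegative derivative
    remains.\<close>
  have incr: "f s + k * \<phi> * (t - s) \<le> f t" if st: "0 \<le> s" "s \<le> t" and \<phi>: "\<And>r. r \<in> {s..t} \<Longrightarrow> \<phi> \<le> \<delta> r" for s t \<phi>
  proof -
    have "f s - k * \<phi> * s \<le> f t - k * \<phi> * t"
    proof (rule absolutely_continuous_nondecreasing[OF st(2), where f = "\<lambda>r. f r - k * \<phi> * r"])
      show "absolutely_continuous_on {s..t} (\<lambda>r. f r - k * \<phi> * r)"
      proof (rule Lipschitz_absolutely_continuous)
        show "0 \<le> L * D + \<bar>k * \<phi>\<bar>" using L D by simp
        fix x y :: real assume "x \<le> y" "{x..y} \<subseteq> {s..t}"
        then have "\<bar>f x - f y\<bar> \<le> L * D * (y - x)"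
          using f_Lip[of x y] st by simp
        moreover have "\<bar>k * \<phi> * x - k * \<phi> * y\<bar> = \<bar>k * \<phi>\<bar> * (y - x)"
          using \<open>x \<le> y\<close> by (simp add: right_diff_distrib[symmetric] abs_mult)
        ultimately show "dist (f x - k * \<phi> * x) (f y - k * \<phi> * y) \<le> (L * D + \<bar>k * \<phi>\<bar>) * (y - x)"
          unfolding dist_real_def distrib_right by linarith
      qed
      show "AE r in lborel. r \<in> {s..t} \<longrightarrow>
          (\<exists>d\<ge>0. ((\<lambda>r. f r - k * \<phi> * r) has_real_derivative d) (at r within {s..t}))"
        using ae
      proof eventually_elim
        case (elim r)
        show ?case
        proof
          assume r: "r \<in> {s..t}"
          then obtain d where d: "k * \<delta> r \<le> d" "(f has_real_derivative d) (at r within {0..})"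
            using elim st unfolding \<delta>_def f_def by auto
          have "(f has_real_derivative d) (at r within {s..t})"
            using d(2) by (rule DERIV_subset) (use st in auto)
          then have "((\<lambda>r. f r - k * \<phi> * r) has_real_derivative (d - k * \<phi>)) (at r within {s..t})"
            by (auto intro!: derivative_eq_intros)
          moreover have "k * \<phi> \<le> k * \<delta> r"
            using \<phi>[OF r] k by simp
          ultimately show "\<exists>d\<ge>0. ((\<lambda>r. f r - k * \<phi> * r) has_real_derivative d) (at r within {s..t})"
            using d(1) by (intro exI[of _ "d - k * \<phi>"]) auto
        qed
      qed
    qed
    then show ?thesis by (simp add: algebra_simps)
  qed
  have mono: "f s \<le> f t" if "0 \<le> s" "s \<le> t" for s t
    using incr[OF that, of 0] \<delta>0 by simp
  define Uinf where "Uinf = (SUP t\<in>{0..}. f t)"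
  define g where "g t = Uinf - f t" for t
  have bddf: "bdd_above (f ` {0..})"
    using bdd by (auto simp: bdd_above_def f_def)
  have g0: "0 \<le> g t" if "0 \<le> t" for t
    unfolding g_def Uinf_def using cSUP_upper[OF _ bddf, of t] that by simp
  have g_decr: "g t \<le> g s" if "0 \<le> s" "s \<le> t" for s t
    using mono[OF that] by (simp add: g_def)
  have g_lim: "\<exists>T\<ge>0. \<forall>t\<ge>T. g t < e" if "e > 0" for e
  proof -
    have "\<exists>x\<in>f ` {0..}. Uinf - e < x"
      unfolding Uinf_def using that bddf by (intro less_cSupD) auto
    then obtain T where "T \<ge> 0" "Uinf - e < f T" by auto
    then show ?thesis
      using mono[of T] by (intro exI[of _ T]) (force simp: g_def)
  qed
  text \<open>The path moves at bounded speed, so while it is \<open>\<delta> t\<close> away from \<open>E\<close> the potential rises for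
    a time proportional to \<open>\<delta> t\<close>.\<close>
  have sq: "(\<delta> t)\<^sup>2 \<le> 4 * D / k * g t" if t: "0 \<le> t" for t
  proof -
    define h where "h = \<delta> t / (2 * D)"
    have h: "0 \<le> h" "D * h = \<delta> t / 2" using D \<delta>0 by (auto simp: h_def)
    have "f t + k * (\<delta> t / 2) * (t + h - t) \<le> f (t + h)"
    proof (rule incr)
      fix r assume r: "r \<in> {t..t + h}"
      have "\<bar>\<delta> r - \<delta> t\<bar> \<le> dist (m r) (m t)"
        unfolding \<delta>_def by (rule infdist_triangle_abs)
      also have "\<dots> \<le> D * \<bar>r - t\<bar>" using D(2)[of r t] r t by simp
      also have "\<dots> \<le> D * h" using r D(1) by simp
      finally show "\<delta> t / 2 \<le> \<delta> r" using h by linarith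
    qed (use t h in auto)
    moreover have "0 \<le> g (t + h)" using t h by (intro g0) auto
    ultimately have "k * (\<delta> t / 2) * h \<le> g t" by (simp add: g_def)
    then show ?thesis using D k by (simp add: h_def field_simps power2_eq_square)
  qed
  have late: "\<exists>T\<ge>0. \<forall>t\<ge>T. g t \<le> L * \<delta> t"
  proof -
    obtain e where e: "e > 0" "\<And>x. x \<in> U ` E \<Longrightarrow> x \<noteq> Uinf \<Longrightarrow> e \<le> dist Uinf x"
      using finite_set_avoid[of "U ` E" Uinf] E(1) by auto
    \<comment> \<open>The second bound gives \<open>L * \<delta> t < e / 2\<close> through
      \<open>sq\<close>. Together with \<open>g t < e / 2\<close> it puts the value of
      \<open>U\<close> at the nearest point of \<open>E\<close> within \<open>e\<close> of
      \<open>Uinf\<close>; as \<open>e\<close> separates \<open>Uinf\<close> from all other values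
      on \<open>E\<close>, that value is \<open>Uinf\<close>.\<close>
    define e' where "e' = min (e / 2) ((e / (2 * L))\<^sup>2 * k / (4 * D))"
    have "e' > 0" using e L D k by (simp add: e'_def)
    then obtain T where T: "T \<ge> 0" "\<And>t. t \<ge> T \<Longrightarrow> g t < e'" using g_lim by blast
    have "g t \<le> L * \<delta> t" if "t \<ge> T" for t
    proof -
      have t: "0 \<le> t" using T that by simp
      have ge: "g t < e / 2" "g t < (e / (2 * L))\<^sup>2 * k / (4 * D)"
        using T(2)[OF that] by (auto simp: e'_def)
      have "(\<delta> t)\<^sup>2 \<le> 4 * D / k * g t" by (rule sq[OF t])
      also have "\<dots> < 4 * D / k * ((e / (2 * L))\<^sup>2 * k / (4 * D))"
        using ge(2) D k by (intro mult_strict_left_mono) auto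
      also have "\<dots> = (e / (2 * L))\<^sup>2" using D k by simp
      finally have "\<delta> t < e / (2 * L)"
        by (rule power_less_imp_less_base) (use e L in auto)
      then have Le: "L * \<delta> t < e / 2" using L by (simp add: field_simps)
      obtain p where p: "p \<in> E" "\<delta> t = dist (m t) p"
        unfolding \<delta>_def using infdist_attains_inf[OF finite_imp_closed[OF E(1)] E(2)] by blast
      have Up: "\<bar>U p - f t\<bar> \<le> L * \<delta> t"
        unfolding f_def p(2) using L(2)[of p "m t"] p(1) E(3) mS[OF t] by (auto simp: dist_commute)
      then have "\<bar>Uinf - U p\<bar> < e"
        using Le ge(1) g0[OF t] by (auto simp: g_def)
      then have "U p = Uinf"
        using e(2)[of "U p"] p(1) by (force simp: dist_real_def)
      then show ?thesis using Up by (simp add: g_def)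
    qed
    then show ?thesis using T(1) by blast
  qed
  then obtain T where T: "T \<ge> 0" "\<And>t. t \<ge> T \<Longrightarrow> g t \<le> L * \<delta> t" by blast
  \<comment> \<open>On \<open>{s..s + 1}\<close> the distance is at least
    \<open>g (s + 1) / L\<close>, so \<open>f\<close> gains at least
    \<open>k / L * g (s + 1)\<close> during this unit of time.\<close>
  define q where "q = 1 + k / L"
  have q: "1 < q" using k L by (simp add: q_def)
  have step: "q * g (s + 1) \<le> g s" if s: "T \<le> s" for s
  proof -
    have "f s + k * (g (s + 1) / L) * (s + 1 - s) \<le> f (s + 1)"
    proof (rule incr)
      fix r assume r: "r \<in> {s..s + 1}"
      have "g (s + 1) \<le> g r" using r s T by (intro g_decr) auto
      also have "\<dots> \<le> L * \<delta> r" using r s by (intro T(2)) auto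
      finally show "g (s + 1) / L \<le> \<delta> r" using L by (simp add: field_simps)
    qed (use s T in auto)
    then show ?thesis by (simp add: q_def g_def algebra_simps diff_divide_distrib)
  qed
  obtain M where M: "M > 0" "\<And>t. 0 \<le> t \<Longrightarrow> g t \<le> M * exp (- ln q * t)"
    using geometric_decay_imp_exponential[of g T q, OF g_decr g0 T(1) q step] by blast
  \<comment> \<open>The distance is bounded by the square root of the gap, hence half the
    rate.\<close>
  have "\<delta> t \<le> sqrt (4 * D / k * M) * exp (- (ln q / 2) * t)" if t: "0 \<le> t" for t
  proof (rule power2_le_imp_le)
    have "(\<delta> t)\<^sup>2 \<le> 4 * D / k * g t" by (rule sq[OF t])
    also have "\<dots> \<le> 4 * D / k * (M * exp (- ln q * t))"
      using M(2)[OF t] D k by (intro mult_left_mono) auto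
    also have "\<dots> = (sqrt (4 * D / k * M) * exp (- (ln q / 2) * t))\<^sup>2"
      using M D k by (simp add: power_mult_distrib exp_double[symmetric])
    finally show "(\<delta> t)\<^sup>2 \<le> (sqrt (4 * D / k * M) * exp (- (ln q / 2) * t))\<^sup>2" .
  qed (use M D k in auto)
  moreover have "sqrt (4 * D / k * M) > 0" "ln q / 2 > 0"
    using M D k q by auto
  ultimately show ?thesis
    unfolding \<delta>_def by blast
qed

subsection \<open>Mixed profiles and regret\<close>

text \<open>All masses are kept, including those of the base actions, so that profiles do not depend
  on a coordinate system. Entries outside \<open>Y\<close> are fixed to 0 because one vector type
  serves all action sets.\<close>

definition profile_set :: "('p::finite \<Rightarrow> 'a::finite set) \<Rightarrow> (real^('p \<times> 'a)) set" where
  "profile_set Y = {m. (\<forall>i a. 0 \<le> m $ (i, a)) \<and> (\<forall>i a. a \<notin> Y i \<longrightarrow> m $ (i, a) = 0) \<and>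
     (\<forall>i. (\<Sum>a\<in>Y i. m $ (i, a)) = 1)}"

definition expected ::
  "('p::finite \<Rightarrow> 'a::finite set) \<Rightarrow> (('p \<Rightarrow> 'a) \<Rightarrow> real) \<Rightarrow> real^('p \<times> 'a) \<Rightarrow> real" where
  "expected Y u m = (\<Sum>y\<in>action_profiles Y. u y * (\<Prod>j\<in>UNIV. m $ (j, y j)))"

text \<open>The factor of player \<open>i\<close> is left out, so this is the partial derivative of
  \<open>expected\<close> in the mass of \<open>(i, a)\<close> and does not depend on the masses of
  player \<open>i\<close>.\<close>

definition payoff ::
  "('p::finite \<Rightarrow> 'a::finite set) \<Rightarrow> (('p \<Rightarrow> 'a) \<Rightarrow> real) \<Rightarrow> real^('p \<times> 'a) \<Rightarrow> 'p \<Rightarrow> 'a \<Rightarrow> real" where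
  "payoff Y u m i a = (\<Sum>y \<in> {y \<in> action_profiles Y. y i = a}. u y * (\<Prod>j\<in>UNIV - {i}. m $ (j, y j)))"

text \<open>For a profile this is the total switching flow of the pairwise comparison (Smith)
  dynamics in which every player is paid the potential.\<close>

definition regret ::
  "('p::finite \<Rightarrow> 'a::finite set) \<Rightarrow> (('p \<Rightarrow> 'a) \<Rightarrow> real) \<Rightarrow> real^('p \<times> 'a) \<Rightarrow> real" where
  "regret Y u m = (\<Sum>i\<in>UNIV. \<Sum>a\<in>Y i. \<Sum>a'\<in>Y i.
     max 0 (m $ (i, a) * (payoff Y u m i a' - payoff Y u m i a)))"

lemma profile_setD:
  assumes "m \<in> profile_set Y"
  shows "0 \<le> m $ (i, a)" "a \<notin> Y i \<Longrightarrow> m $ (i, a) = 0" "(\<Sum>a\<in>Y i. m $ (i, a)) = 1" "m $ (i, a) \<le> 1"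
proof -
  show 1: "0 \<le> m $ (i, a)" "a \<notin> Y i \<Longrightarrow> m $ (i, a) = 0" "(\<Sum>a\<in>Y i. m $ (i, a)) = 1" for a
    using assms by (auto simp: profile_set_def)
  show "m $ (i, a) \<le> 1"
  proof (cases "a \<in> Y i")
    case True
    then have "m $ (i, a) \<le> (\<Sum>a\<in>Y i. m $ (i, a))"
      using 1 by (intro member_le_sum) auto
    then show ?thesis using 1 by simp
  qed (simp add: 1)
qed

text \<open>Profiles are grouped by the action of player \<open>i\<close>. Taking \<open>h\<close>
  to be masses gives the expected potential, taking differences of masses gives its derivative along
  a path.\<close>

lemma sum_action_profiles:
  "(\<Sum>y\<in>action_profiles Y. u y * (h (y i) * (\<Prod>j\<in>UNIV - {i}. m $ (j, y j)))) =
   (\<Sum>a\<in>Y i. h a * payoff Y u m i a)"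
proof -
  have "(\<Sum>a\<in>Y i. h a * payoff Y u m i a) =
      (\<Sum>a\<in>Y i. \<Sum>y \<in> {y \<in> action_profiles Y. y i = a}. u y * (h (y i) * (\<Prod>j\<in>UNIV - {i}. m $ (j, y j))))"
    unfolding payoff_def sum_distrib_left by (intro sum.cong) (auto simp: mult_ac)
  also have "\<dots> = (\<Sum>y\<in>action_profiles Y. u y * (h (y i) * (\<Prod>j\<in>UNIV - {i}. m $ (j, y j))))"
    by (rule sum.group) (auto simp: action_profiles_def PiE_def)
  finally show ?thesis ..
qed

lemma expected_eq: "expected Y u m = (\<Sum>a\<in>Y i. m $ (i, a) * payoff Y u m i a)"
proof -
  have "expected Y u m = (\<Sum>y\<in>action_profiles Y. u y * (m $ (i, y i) * (\<Prod>j\<in>UNIV - {i}. m $ (j, y j))))"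
    unfolding expected_def by (intro sum.cong refl, subst prod.remove[of _ i]) auto
  also have "\<dots> = (\<Sum>a\<in>Y i. m $ (i, a) * payoff Y u m i a)"
    by (rule sum_action_profiles)
  finally show ?thesis .
qed

lemma payoff_cong:
  "(\<And>j a. j \<noteq> i \<Longrightarrow> m $ (j, a) = m' $ (j, a)) \<Longrightarrow> payoff Y u m i a = payoff Y u m' i a"
  unfolding payoff_def by (intro sum.cong refl arg_cong2[where f = times] prod.cong) auto

lemma axis_Pair_nth: "axis (i, a) x $ (j, e) = (if i = j \<and> a = e then x else 0)"
  by (auto simp: axis_def)

text \<open>Moving mass between two actions of one player leaves that player's payoffs unchanged, so
  the effect is linear. It is used for deviations from a maximizer and for partial
  derivatives.\<close>

lemma expected_shift:
  assumes "a \<in> Y i" "a' \<in> Y i"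
  shows "expected Y u (m + t *\<^sub>R (axis (i, a) 1 - axis (i, a') 1)) =
    expected Y u m + t * (payoff Y u m i a - payoff Y u m i a')"
proof -
  let ?m = "m + t *\<^sub>R (axis (i, a) 1 - axis (i, a') 1)"
  have eq: "payoff Y u ?m i e = payoff Y u m i e" for e
    by (rule payoff_cong) (simp add: axis_Pair_nth)
  have "expected Y u ?m = (\<Sum>e\<in>Y i. m $ (i, e) * payoff Y u m i e +
      (if e = a then t * payoff Y u m i e else 0) - (if e = a' then t * payoff Y u m i e else 0))"
    unfolding expected_eq[of Y u ?m i] eq by (intro sum.cong) (auto simp: axis_Pair_nth algebra_simps)
  then show ?thesis
    using assms by (simp add: sum.distrib sum_subtractf expected_eq[of Y u m i] algebra_simps)
qed

lemma continuous_on_payoff [continuous_intros]: "continuous_on S (\<lambda>m. payoff Y u m i a)"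
  unfolding payoff_def by (intro continuous_intros)

lemma continuous_on_expected [continuous_intros]: "continuous_on S (expected Y u)"
  unfolding expected_def by (intro continuous_intros)

lemma continuous_on_regret: "continuous_on S (regret Y u)"
  unfolding regret_def by (intro continuous_intros)

lemma payoff_has_derivative: "\<exists>L. ((\<lambda>m. payoff Y u m i a) has_derivative L) (at m)"
  unfolding payoff_def by (rule exI, (rule derivative_intros bounded_linear.has_derivative[OF bounded_linear_vec_nth])+)

lemma expected_Lipschitz:
  "\<exists>L>0. \<forall>v\<in>profile_set Y. \<forall>w\<in>profile_set Y. \<bar>expected Y u v - expected Y u w\<bar> \<le> L * dist v w"
proof -
  \<comment> \<open>Here \<open>'a\<close> is the type of players: each of the factors of a product
    lies in the unit interval and changes by at most \<open>dist v w\<close>. The summand 1 makes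
    \<open>L\<close> positive.\<close>
  define L where "L = (\<Sum>y\<in>action_profiles Y. \<bar>u y\<bar> * CARD('a)) + 1"
  have "\<bar>expected Y u v - expected Y u w\<bar> \<le> L * dist v w"
    if v: "v \<in> profile_set Y" and w: "w \<in> profile_set Y" for v w
  proof -
    have prod: "\<bar>(\<Prod>j\<in>UNIV. v $ (j, y j)) - (\<Prod>j\<in>UNIV. w $ (j, y j))\<bar> \<le> CARD('a) * dist v w" for y
    proof -
      have "\<bar>(\<Prod>j\<in>UNIV. v $ (j, y j)) - (\<Prod>j\<in>UNIV. w $ (j, y j))\<bar> \<le> (\<Sum>j\<in>UNIV. \<bar>v $ (j, y j) - w $ (j, y j)\<bar>)"
        using norm_prod_diff[of UNIV "\<lambda>j. v $ (j, y j)" "\<lambda>j. w $ (j, y j)"] profile_setD[OF v] profile_setD[OF w]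
        by simp
      also have "\<dots> \<le> (\<Sum>j\<in>(UNIV :: 'a set). dist v w)"
        by (intro sum_mono) (metis dist_vec_nth_le dist_real_def)
      finally show ?thesis by simp
    qed
    have "\<bar>expected Y u v - expected Y u w\<bar> \<le>
        (\<Sum>y\<in>action_profiles Y. \<bar>u y * ((\<Prod>j\<in>UNIV. v $ (j, y j)) - (\<Prod>j\<in>UNIV. w $ (j, y j)))\<bar>)"
      unfolding expected_def sum_subtractf[symmetric] right_diff_distrib by (rule sum_abs)
    also have "\<dots> \<le> (\<Sum>y\<in>action_profiles Y. \<bar>u y\<bar> * (CARD('a) * dist v w))"
      unfolding abs_mult by (intro sum_mono mult_left_mono prod) auto
    also have "\<dots> \<le> L * dist v w"
      by (simp add: L_def sum_distrib_right mult.assoc distrib_right)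
    finally show ?thesis .
  qed
  moreover have "L > 0"
    unfolding L_def by (intro add_nonneg_pos sum_nonneg) auto
  ultimately show ?thesis by blast
qed

section \<open>Bounds on the regret, and existence of a profile with regret zero\<close>

lemma regret_nonneg: "0 \<le> regret Y u m"
  unfolding regret_def by (intro sum_nonneg) auto

lemma regret_ge:
  assumes "a \<in> Y i" "a' \<in> Y i"
  shows "m $ (i, a) * (payoff Y u m i a' - payoff Y u m i a) \<le> regret Y u m"
proof -
  let ?f = "\<lambda>i a a'. max 0 (m $ (i, a) * (payoff Y u m i a' - payoff Y u m i a))"
  have "m $ (i, a) * (payoff Y u m i a' - payoff Y u m i a) \<le> ?f i a a'" by simp
  also have "\<dots> \<le> (\<Sum>a'\<in>Y i. ?f i a a')" by (rule member_le_sum) (use assms in auto)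
  also have "\<dots> \<le> (\<Sum>a\<in>Y i. \<Sum>a'\<in>Y i. ?f i a a')"
    by (rule member_le_sum[of a "Y i" "\<lambda>a. \<Sum>a'\<in>Y i. ?f i a a'"]) (use assms in \<open>auto intro: sum_nonneg\<close>)
  also have "\<dots> \<le> regret Y u m"
    unfolding regret_def
    by (rule member_le_sum[of i UNIV "\<lambda>i. \<Sum>a\<in>Y i. \<Sum>a'\<in>Y i. ?f i a a'"]) (auto intro!: sum_nonneg)
  finally show ?thesis .
qed

text \<open>Every single regret term of player \<open>i\<close> is at most the gain
  \<open>G i\<close> from moving to \<open>q\<close>, and there are at most
  \<open>(CARD('a))\<^sup>2\<close> such terms. For a best reply \<open>q\<close> the sum of the
  gains is the growth rate of the potential.\<close>

lemma regret_le_gain: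
  fixes Y :: "'p::finite \<Rightarrow> 'a::finite set"
  assumes m: "m \<in> profile_set Y"
    and best: "\<And>i a'. a' \<in> Y i \<Longrightarrow> payoff Y u m i a' \<le> (\<Sum>a\<in>Y i. q $ (i, a) * payoff Y u m i a)"
  shows "regret Y u m \<le> (CARD('a))\<^sup>2 * (\<Sum>i\<in>UNIV. \<Sum>a\<in>Y i. (q $ (i, a) - m $ (i, a)) * payoff Y u m i a)"
proof -
  define G where "G i = (\<Sum>a\<in>Y i. (q $ (i, a) - m $ (i, a)) * payoff Y u m i a)" for i
  have le: "max 0 (m $ (i, a) * (payoff Y u m i a' - payoff Y u m i a)) \<le> G i" if "a \<in> Y i" "a' \<in> Y i" for i a a'
  proof -
    define B where "B = (\<Sum>a\<in>Y i. q $ (i, a) * payoff Y u m i a)"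
    have nn: "0 \<le> m $ (i, a) * (B - payoff Y u m i a)" if "a \<in> Y i" for a
      using profile_setD(1)[OF m] best[OF that] unfolding B_def by (intro mult_nonneg_nonneg) auto
    \<comment> \<open>As the masses add up to 1, the gain is the average shortfall of the actions in
      use from the value \<open>B\<close>; all its terms are nonnegative.\<close>
    have "G i = B * (\<Sum>a\<in>Y i. m $ (i, a)) - (\<Sum>a\<in>Y i. m $ (i, a) * payoff Y u m i a)"
      by (simp add: G_def B_def profile_setD(3)[OF m] sum_subtractf left_diff_distrib)
    also have "\<dots> = (\<Sum>a\<in>Y i. m $ (i, a) * (B - payoff Y u m i a))"
      by (simp add: right_diff_distrib sum_subtractf sum_distrib_left mult.commute)
    finally have G: "G i = (\<Sum>a\<in>Y i. m $ (i, a) * (B - payoff Y u m i a))" .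
    have "m $ (i, a) * (payoff Y u m i a' - payoff Y u m i a) \<le> m $ (i, a) * (B - payoff Y u m i a)"
      using profile_setD(1)[OF m] best[OF that(2)] unfolding B_def by (intro mult_left_mono) auto
    also have "\<dots> \<le> G i"
      unfolding G using that nn by (intro member_le_sum[of a "Y i" "\<lambda>a. m $ (i, a) * (B - payoff Y u m i a)"]) auto
    finally show ?thesis
      using nn by (auto simp: G intro!: sum_nonneg)
  qed
  have "(\<Sum>a\<in>Y i. \<Sum>a'\<in>Y i. max 0 (m $ (i, a) * (payoff Y u m i a' - payoff Y u m i a))) \<le> (CARD('a))\<^sup>2 * G i" for i
  proof (cases "Y i = {}")
    case True
    then show ?thesis by (simp add: G_def)
  next
    case False
    then have "0 \<le> G i" using le[of _ i] by fastforce
    have "(\<Sum>a\<in>Y i. \<Sum>a'\<in>Y i. max 0 (m $ (i, a) * (payoff Y u m i a' - payoff Y u m i a))) \<le>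
        (\<Sum>a\<in>Y i. \<Sum>a'\<in>Y i. G i)"
      by (intro sum_mono le)
    also have "\<dots> = (real (card (Y i)))\<^sup>2 * G i" by (simp add: power2_eq_square)
    also have "\<dots> \<le> (CARD('a))\<^sup>2 * G i"
      using \<open>0 \<le> G i\<close> by (intro mult_right_mono) (auto intro!: power_mono card_mono)
    finally show ?thesis .
  qed
  then show ?thesis
    unfolding regret_def G_def[symmetric] sum_distrib_left by (rule sum_mono)
qed

lemma compact_profile_set: "compact (profile_set Y)"
proof -
  have "closed (profile_set Y)"
    unfolding profile_set_def
    by (intro closed_Collect_conj closed_Collect_all closed_Collect_imp closed_Collect_le closed_Collect_eq
        open_Collect_const continuous_intros)
  moreover have "bounded (profile_set Y)"
  proof -
    have "norm m \<le> CARD('a \<times> 'b)" if "m \<in> profile_set Y" for m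
    proof -
      have "norm m \<le> (\<Sum>c\<in>UNIV. \<bar>m $ c\<bar>)" by (rule norm_le_l1_cart)
      also have "\<dots> \<le> (\<Sum>c\<in>(UNIV :: ('a \<times> 'b) set). 1)"
      proof (rule sum_mono)
        fix c :: "'a \<times> 'b"
        show "\<bar>m $ c\<bar> \<le> 1"
          using profile_setD(1,4)[OF that] by (cases c) simp
      qed
      also have "\<dots> = CARD('a \<times> 'b)" by simp
      finally show ?thesis .
    qed
    then show ?thesis by (auto simp: bounded_iff)
  qed
  ultimately show ?thesis by (simp add: compact_eq_bounded_closed)
qed

text \<open>A maximizer of the potential over the compact set of profiles has regret zero, which
  proves existence of an equilibrium by maximization.\<close>

lemma regret_zero_exists:
  assumes b: "\<And>i. b i \<in> Y i"
  shows "\<exists>v\<in>profile_set Y. regret Y u v = 0"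
proof -
  have "(\<chi> c. if snd c = b (fst c) then 1 else 0) \<in> profile_set Y"
    using b by (auto simp: profile_set_def)
  then have "profile_set Y \<noteq> {}" by blast
  then obtain v where v: "v \<in> profile_set Y" and max: "\<And>w. w \<in> profile_set Y \<Longrightarrow> expected Y u w \<le> expected Y u v"
    using continuous_attains_sup[OF compact_profile_set _ continuous_on_expected] by blast
  have "v $ (i, a) * (payoff Y u v i a' - payoff Y u v i a) \<le> 0" if a: "a \<in> Y i" "a' \<in> Y i" for i a a'
  proof (cases "a = a'")
    case False
    \<comment> \<open>All the mass of \<open>a\<close> is moved to \<open>a'\<close>; the change of
      the potential is exactly the term to be bounded.\<close>
    let ?w = "v + v $ (i, a) *\<^sub>R (axis (i, a') 1 - axis (i, a) 1)"
    have nth: "?w $ (j, e) = v $ (j, e) + (if j = i \<and> e = a' then v $ (i, a) else 0) - (if j = i \<and> e = a then v $ (i, a) else 0)" for j e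
      by (auto simp: axis_Pair_nth)
    have "(\<Sum>e\<in>Y j. ?w $ (j, e)) = 1" for j
      unfolding nth using profile_setD(3)[OF v, of j] a by (cases "j = i") (auto simp: sum.distrib sum_subtractf)
    moreover have "0 \<le> ?w $ (j, e)" for j e
      unfolding nth using profile_setD(1)[OF v] False by auto
    moreover have "e \<notin> Y j \<Longrightarrow> ?w $ (j, e) = 0" for j e
      unfolding nth using profile_setD(2)[OF v] a by auto
    ultimately have "?w \<in> profile_set Y" unfolding profile_set_def by blast
    then have "expected Y u ?w \<le> expected Y u v" by (rule max)
    then show ?thesis
      using expected_shift[of a' Y i a u v "v $ (i, a)"] a by simp
  qed simp
  then have "regret Y u v = 0"
    unfolding regret_def by (intro sum.neutral ballI) (simp add: max_absorb1)
  then show ?thesis using v by blast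
qed

section \<open>Derivative of the potential along a path\<close>

lemma has_field_derivative_prod_within:
  assumes "\<And>i. i \<in> I \<Longrightarrow> (f i has_field_derivative f' i) (at x within S)"
  shows "((\<lambda>u. \<Prod>i\<in>I. f i u) has_field_derivative (\<Sum>i\<in>I. f' i * (\<Prod>j\<in>I - {i}. f j x))) (at x within S)"
proof -
  have "((\<lambda>u. \<Prod>i\<in>I. f i u) has_derivative (\<lambda>y. \<Sum>i\<in>I. f' i * y * (\<Prod>j\<in>I - {i}. f j x))) (at x within S)"
    using assms unfolding has_field_derivative_def by (rule has_derivative_prod)
  then show ?thesis
    unfolding has_field_derivative_def by (rule has_derivative_eq_rhs) (auto simp: sum_distrib_left mult_ac)
qed

lemma expected_has_derivative_along:
  fixes m :: "real \<Rightarrow> real^('p::finite \<times> 'a::finite)"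
  assumes "\<And>c. ((\<lambda>s. m s $ c) has_real_derivative (q $ c - m t $ c)) (at t within T)"
  shows "((\<lambda>s. expected Y u (m s)) has_real_derivative
    (\<Sum>i\<in>UNIV. \<Sum>a\<in>Y i. (q $ (i, a) - m t $ (i, a)) * payoff Y u (m t) i a)) (at t within T)"
proof -
  have "((\<lambda>s. expected Y u (m s)) has_real_derivative
      (\<Sum>y\<in>action_profiles Y. u y * (\<Sum>i\<in>UNIV. (q $ (i, y i) - m t $ (i, y i)) * (\<Prod>j\<in>UNIV - {i}. m t $ (j, y j))))) (at t within T)"
    unfolding expected_def
    by (intro DERIV_sum DERIV_cmult has_field_derivative_prod_within assms)
  also have "(\<Sum>y\<in>action_profiles Y. u y * (\<Sum>i\<in>UNIV. (q $ (i, y i) - m t $ (i, y i)) * (\<Prod>j\<in>UNIV - {i}. m t $ (j, y j)))) =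
      (\<Sum>i\<in>UNIV. \<Sum>a\<in>Y i. (q $ (i, a) - m t $ (i, a)) * payoff Y u (m t) i a)"
    unfolding sum_distrib_left
    by (subst sum.swap) (intro sum.cong refl sum_action_profiles[where h = "\<lambda>a. q $ (i, a) - m t $ (i, a)" for i])
  finally show ?thesis .
qed

subsection \<open>The error bound at regular equilibria\<close>

lemma has_derivative_nhds_bound:
  assumes "(f has_derivative L) (at v)" "e > 0"
  shows "\<forall>\<^sub>F w in nhds v. norm (f w - f v - L (w - v)) \<le> e * norm (w - v)"
proof -
  obtain d where "d > 0" "\<And>w. norm (w - v) < d \<Longrightarrow> norm (f w - f v - L (w - v)) \<le> e * norm (w - v)"
    using assms unfolding has_derivative_at_alt by blast
  then show ?thesis
    unfolding eventually_nhds_metric by (auto simp: dist_norm)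
qed

text \<open>A finite subcover reduces to finitely many local constants, and nonnegativity of
  \<open>g\<close> allows replacing each of them by a common larger one.\<close>

lemma compact_local_bound:
  fixes f g :: "'b::topological_space \<Rightarrow> real"
  assumes S: "compact S" and g: "\<And>w. w \<in> S \<Longrightarrow> 0 \<le> g w"
    and loc: "\<And>v. v \<in> S \<Longrightarrow> \<exists>K. \<forall>\<^sub>F w in nhds v. w \<in> S \<longrightarrow> f w \<le> K * g w"
  shows "\<exists>K>0. \<forall>w\<in>S. f w \<le> K * g w"
proof -
  have "\<forall>v\<in>S. \<exists>K A. open A \<and> v \<in> A \<and> (\<forall>w\<in>A. w \<in> S \<longrightarrow> f w \<le> K * g w)"
    using loc unfolding eventually_nhds by blast
  then obtain K A where KA: "\<And>v. v \<in> S \<Longrightarrow> open (A v)" "\<And>v. v \<in> S \<Longrightarrow> v \<in> A v"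
    "\<And>v w. v \<in> S \<Longrightarrow> w \<in> A v \<Longrightarrow> w \<in> S \<Longrightarrow> f w \<le> K v * g w"
    by metis
  obtain C where C: "C \<subseteq> S" "finite C" "S \<subseteq> (\<Union>c\<in>C. A c)"
    using compactE_image[OF S, of S A] KA(1,2) by blast
  define M where "M = (\<Sum>c\<in>C. \<bar>K c\<bar>) + 1"
  have "f w \<le> M * g w" if w: "w \<in> S" for w
  proof -
    obtain c where c: "c \<in> C" "w \<in> A c" using C w by blast
    have "K c \<le> \<bar>K c\<bar>" by simp
    also have "\<dots> \<le> (\<Sum>c\<in>C. \<bar>K c\<bar>)"
      using c C(2) by (intro member_le_sum[of c C "\<lambda>c. \<bar>K c\<bar>"]) auto
    finally have "K c \<le> M" by (simp add: M_def)
    then have "K c * g w \<le> M * g w" using g[OF w] by (rule mult_right_mono)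
    then show ?thesis using KA(3)[of c w] c C(1) w by force
  qed
  moreover have "M > 0" unfolding M_def by (intro add_nonneg_pos sum_nonneg) auto
  ultimately show ?thesis by blast
qed

text \<open>The direction in which coordinate \<open>c\<close> grows: the base action of the same
  player pays for the added mass.\<close>

definition shift :: "('p \<Rightarrow> 'a) \<Rightarrow> 'p \<times> 'a \<Rightarrow> real^('p::finite \<times> 'a::finite)" where
  "shift b c = axis c 1 - axis (fst c, b (fst c)) 1"

text \<open>This is the partial derivative of the multilinear extension in coordinate
  \<open>c\<close>, as a function of the masses.\<close>

definition advantage ::
  "('p::finite \<Rightarrow> 'a::finite set) \<Rightarrow> ('p \<Rightarrow> 'a) \<Rightarrow> (('p \<Rightarrow> 'a) \<Rightarrow> real) \<Rightarrow> 'p \<times> 'a \<Rightarrow> real^('p \<times> 'a) \<Rightarrow> real" where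
  "advantage Y b u c m = payoff Y u m (fst c) (snd c) - payoff Y u m (fst c) (b (fst c))"

lemma norm_shift: "norm (shift b c) \<le> 2"
  unfolding shift_def using norm_triangle_ineq4[of "axis c 1" "axis (fst c, b (fst c)) (1::real)"]
  by (simp add: norm_axis_1)

text \<open>Both profiles have total mass 1 for each player, so the change in the base mass is minus
  the sum of the other changes.\<close>

lemma profile_diff_eq:
  assumes b: "\<And>i. b i \<in> Y i" and v: "v \<in> profile_set Y" and w: "w \<in> profile_set Y"
  shows "w - v = (\<Sum>c\<in>coords Y b. (w - v) $ c *\<^sub>R shift b c)"
proof -
  have "(\<Sum>c\<in>coords Y b. (w - v) $ c *\<^sub>R shift b c) $ (j, e) = (w - v) $ (j, e)" for j e
  proof -
    have "(\<Sum>c\<in>coords Y b. (w - v) $ c *\<^sub>R shift b c) $ (j, e) =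
        (\<Sum>i\<in>UNIV. \<Sum>a\<in>Y i - {b i}. (w - v) $ (i, a) * shift b (i, a) $ (j, e))"
      unfolding coords_def by (subst sum.Sigma) (auto simp: case_prod_beta)
    also have "\<dots> = (\<Sum>a\<in>Y j - {b j}. (w - v) $ (j, a) * shift b (j, a) $ (j, e))"
      by (rule sum.remove[of UNIV j, THEN trans]) (auto simp: shift_def axis_Pair_nth intro!: sum.neutral)
    also have "\<dots> = (w - v) $ (j, e)"
    proof (cases "e = b j")
      case True
      have "(\<Sum>a\<in>Y j - {b j}. (w - v) $ (j, a) * shift b (j, a) $ (j, e)) = - (\<Sum>a\<in>Y j - {b j}. (w - v) $ (j, a))"
        unfolding sum_negf[symmetric] using True by (intro sum.cong) (auto simp: shift_def axis_Pair_nth)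
      moreover have "(\<Sum>a\<in>Y j. (w - v) $ (j, a)) = 0"
        by (simp add: sum_subtractf profile_setD(3)[OF v] profile_setD(3)[OF w])
      then have "(w - v) $ (j, b j) + (\<Sum>a\<in>Y j - {b j}. (w - v) $ (j, a)) = 0"
        using sum.remove[of "Y j" "b j" "\<lambda>a. (w - v) $ (j, a)"] b by simp
      ultimately show ?thesis using True by simp
    next
      case False
      have "(\<Sum>a\<in>Y j - {b j}. (w - v) $ (j, a) * shift b (j, a) $ (j, e)) =
          (\<Sum>a\<in>Y j - {b j}. if a = e then (w - v) $ (j, e) else 0)"
        using False by (intro sum.cong) (auto simp: shift_def axis_Pair_nth)
      then show ?thesis
        using False profile_setD(2)[OF v, of e j] profile_setD(2)[OF w, of e j] by simp
    qed
    finally show ?thesis .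
  qed
  then show ?thesis by (simp add: vec_eq_iff split_paired_all)
qed

text \<open>In the coordinates given by a base action in the support, the map sending a profile to the
  advantages of the supported actions and the masses of the unsupported ones vanishes at the
  equilibrium and has an invertible derivative there; each of its components is at most a multiple
  of the regret.\<close>

lemma regret_lower_bound:
  assumes v: "v \<in> profile_set Y" "regret Y u v = 0"
    and b: "\<And>i. b i \<in> Y i" "\<And>i. 0 < v $ (i, b i)"
    and first: "\<And>i a. a \<in> Y i \<Longrightarrow> v $ (i, a) = 0 \<Longrightarrow> advantage Y b u (i, a) v \<noteq> 0"
    and J: "J = {c \<in> coords Y b. 0 < v $ c}"
    and L: "\<And>d. (advantage Y b u d has_derivative L d) (at v)"
    and inv: "invertible_matrix_on J (\<lambda>c d. L d (shift b c))"
  shows "\<exists>K. \<forall>\<^sub>F w in nhds v. w \<in> profile_set Y \<longrightarrow> dist w v \<le> K * regret Y u w"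
proof -
  let ?C = "coords Y b"
  let ?R = "regret Y u"
  let ?f = "advantage Y b u"
  \<comment> \<open>The sizes of the components of the map described above; at profiles the masses
    are nonnegative and equal their absolute values.\<close>
  define G where "G c w = (if c \<in> J then \<bar>?f c w\<bar> else w $ c)" for c w
  have b_best: "payoff Y u v i a \<le> payoff Y u v i (b i)" if "a \<in> Y i" for i a
    using regret_ge[of "b i" Y i a v u, OF b(1) that] b(2)[of i] v(2) by (auto simp: mult_le_0_iff)
  have pos: "\<forall>\<^sub>F w in nhds v. v $ c / 2 < w $ c" if "0 < v $ c" for c
  proof -
    have "((\<lambda>w. w $ c) \<longlongrightarrow> v $ c) (nhds v)"
      by (intro tendsto_vec_nth filterlim_ident)
    then show ?thesis by (rule order_tendstoD(1)) (use that in simp)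
  qed
  have G_le: "\<exists>K. \<forall>\<^sub>F w in nhds v. w \<in> profile_set Y \<longrightarrow> G c w \<le> K * ?R w" if c: "c \<in> ?C" for c
  proof -
    obtain i a where c_eq: "c = (i, a)" and a: "a \<in> Y i" "a \<noteq> b i"
      using c by (auto simp: coords_def)
    show ?thesis
    proof (cases "c \<in> J")
      case True
      then have "0 < v $ (i, a)" using J c_eq by simp
      \<comment> \<open>Near \<open>v\<close> both masses exceed \<open>\<mu>\<close>. The sign of
        the advantage decides which of the two actions is the worse one, and its switch to the other
        one contributes to the regret.\<close>
      define \<mu> where "\<mu> = min (v $ (i, a)) (v $ (i, b i)) / 2"
      have \<mu>: "\<mu> > 0" using \<open>0 < v $ (i, a)\<close> b(2) by (simp add: \<mu>_def)
      have "\<forall>\<^sub>F w in nhds v. w \<in> profile_set Y \<longrightarrow> G c w \<le> 1 / \<mu> * ?R w"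
        using pos[OF \<open>0 < v $ (i, a)\<close>] pos[OF b(2)[of i]]
      proof eventually_elim
        case (elim w)
        have \<mu>w: "\<mu> \<le> w $ (i, a)" "\<mu> \<le> w $ (i, b i)" using elim by (auto simp: \<mu>_def min_def)
        have "\<mu> * \<bar>?f c w\<bar> \<le> ?R w"
        proof (cases "0 \<le> ?f c w")
          case True
          then have "\<mu> * ?f c w \<le> w $ (i, b i) * ?f c w" using \<mu>w by (intro mult_right_mono)
          also have "\<dots> \<le> ?R w"
            using regret_ge[of "b i" Y i a w u, OF b(1) a(1)] by (simp add: advantage_def c_eq)
          finally show ?thesis using True by simp
        next
          case False
          then have "\<mu> * (- ?f c w) \<le> w $ (i, a) * (- ?f c w)" using \<mu>w by (intro mult_right_mono) auto
          also have "\<dots> \<le> ?R w"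
            using regret_ge[of a Y i "b i" w u, OF a(1) b(1)] by (simp add: advantage_def c_eq)
          finally show ?thesis using False by simp
        qed
        then show ?case using True \<mu> by (simp add: G_def field_simps)
      qed
      then show ?thesis by blast
    next
      case False
      then have va: "v $ (i, a) = 0"
        using c c_eq J profile_setD(1)[OF v(1), of i a] by force
      \<comment> \<open>First-order non-degeneracy makes the unsupported action strictly worse at
        \<open>v\<close>; by continuity half of the loss persists nearby, and the regret is at least
        \<open>\<gamma>\<close> times its mass.\<close>
      define \<gamma> where "\<gamma> = - ?f c v / 2"
      have \<gamma>: "\<gamma> > 0"
        using first[OF a(1) va] b_best[OF a(1)] by (simp add: \<gamma>_def advantage_def c_eq)
      have "continuous_on UNIV (?f c)"
        unfolding advantage_def by (intro continuous_intros)
      then have "(?f c \<longlongrightarrow> ?f c v) (nhds v)"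
        by (simp add: continuous_on_eq_continuous_at isCont_def tendsto_at_iff_tendsto_nhds[symmetric])
      then have "\<forall>\<^sub>F w in nhds v. ?f c w < - \<gamma>"
        by (rule order_tendstoD(2)) (use \<gamma> in \<open>simp add: \<gamma>_def\<close>)
      then have "\<forall>\<^sub>F w in nhds v. w \<in> profile_set Y \<longrightarrow> G c w \<le> 1 / \<gamma> * ?R w"
      proof eventually_elim
        case (elim w)
        show ?case
        proof
          assume w: "w \<in> profile_set Y"
          have "w $ (i, a) * \<gamma> \<le> w $ (i, a) * (- ?f c w)"
            using elim profile_setD(1)[OF w] by (intro mult_left_mono) auto
          also have "\<dots> \<le> ?R w"
            using regret_ge[of a Y i "b i" w u, OF a(1) b(1)] by (simp add: advantage_def c_eq)
          finally show "G c w \<le> 1 / \<gamma> * ?R w"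
            using False \<gamma> by (simp add: G_def c_eq field_simps)
        qed
      qed
      then show ?thesis by blast
    qed
  qed
  then have "\<forall>c\<in>?C. \<exists>K. \<forall>\<^sub>F w in nhds v. w \<in> profile_set Y \<longrightarrow> G c w \<le> K * ?R w" ..
  from bchoice[OF this] obtain K
    where K: "\<forall>c\<in>?C. \<forall>\<^sub>F w in nhds v. w \<in> profile_set Y \<longrightarrow> G c w \<le> K c * ?R w" ..
  have finC: "finite ?C" by simp
  have JC: "J \<subseteq> ?C" using J by auto
  have fv: "?f d v = 0" if "d \<in> J" for d
  proof -
    have d: "snd d \<in> Y (fst d)" "0 < v $ (fst d, snd d)" using that J by (auto simp: coords_def)
    have "payoff Y u v (fst d) (b (fst d)) \<le> payoff Y u v (fst d) (snd d)"
      using regret_ge[of "snd d" Y "fst d" "b (fst d)" v u, OF d(1) b(1)] d(2) v(2) by (auto simp: mult_le_0_iff)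
    then show ?thesis using b_best[OF d(1)] by (simp add: advantage_def)
  qed
  define A where "A c d = L d (shift b c)" for c d
  obtain B where B: "\<And>c d. c \<in> J \<Longrightarrow> d \<in> J \<Longrightarrow> (\<Sum>e\<in>J. A c e * B e d) = (if c = d then 1 else 0)"
    using inv unfolding invertible_matrix_on_def A_def by blast
  define \<beta> where "\<beta> = (\<Sum>c\<in>UNIV. \<Sum>d\<in>UNIV. \<bar>A c d\<bar> + \<bar>B c d\<bar>) + 1"
  have AB: "\<bar>A c d\<bar> + \<bar>B c d\<bar> \<le> (\<Sum>c\<in>UNIV. \<Sum>d\<in>UNIV. \<bar>A c d\<bar> + \<bar>B c d\<bar>)" for c d
    by (rule order_trans[OF member_le_sum[of d UNIV "\<lambda>d. \<bar>A c d\<bar> + \<bar>B c d\<bar>"]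
          member_le_sum[of c UNIV "\<lambda>c. \<Sum>d\<in>UNIV. \<bar>A c d\<bar> + \<bar>B c d\<bar>"]]) (auto intro!: sum_nonneg)
  have \<beta>: "\<bar>A c d\<bar> \<le> \<beta>" "\<bar>B c d\<bar> \<le> \<beta>" for c d
    using AB[of c d] abs_ge_zero[of "A c d"] abs_ge_zero[of "B c d"] unfolding \<beta>_def by linarith+
  have \<beta>0: "\<beta> > 0" unfolding \<beta>_def by (intro add_nonneg_pos sum_nonneg) auto
  define n where "n = real (card J)"
  \<comment> \<open>Chosen so that the linearization error, multiplied by the inverse matrix and
    summed over \<open>J\<close>, is at most a quarter of \<open>norm h\<close>. The summand 1
    covers an empty \<open>J\<close>.\<close>
  define \<epsilon> where "\<epsilon> = 1 / (4 * (n * (n * \<beta>)) + 1)"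
  have n0: "0 \<le> n" by (simp add: n_def)
  have nn0: "0 \<le> n * (n * \<beta>)" using n0 \<beta>0 by simp
  have \<epsilon>: "\<epsilon> > 0" "4 * (n * (n * \<beta>)) * \<epsilon> \<le> 1"
    using nn0 by (auto simp: \<epsilon>_def add_nonneg_pos)
  have "\<forall>\<^sub>F w in nhds v. \<forall>d\<in>J. \<bar>?f d w - ?f d v - L d (w - v)\<bar> \<le> \<epsilon> * norm (w - v)"
    using has_derivative_nhds_bound[OF L \<epsilon>(1)] by (intro eventually_ball_finite) auto
  moreover have "\<forall>\<^sub>F w in nhds v. \<forall>c\<in>?C. w \<in> profile_set Y \<longrightarrow> G c w \<le> K c * ?R w"
    using K by (intro eventually_ball_finite) auto
  ultimately have "\<forall>\<^sub>F w in nhds v. w \<in> profile_set Y \<longrightarrow>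
      dist w v \<le> 4 * (1 + n * (n * \<beta>) * (1 + \<beta>)) * (\<Sum>c\<in>?C. K c) * ?R w"
  proof eventually_elim
    case (elim w)
    show ?case
    proof
      assume w: "w \<in> profile_set Y"
      define h where "h = w - v"
      define \<Gamma> where "\<Gamma> = (\<Sum>c\<in>?C. G c w)"
      have G0: "0 \<le> G c w" for c
        using profile_setD(1)[OF w, of "fst c" "snd c"] by (simp add: G_def)
      have \<Gamma>_le: "\<Gamma> \<le> (\<Sum>c\<in>?C. K c) * ?R w"
        unfolding \<Gamma>_def sum_distrib_right using elim(2) w by (intro sum_mono) auto
      have h_off: "\<bar>h $ c\<bar> = G c w" if "c \<in> ?C - J" for c
      proof -
        have "v $ c = 0"
          using that J profile_setD(1)[OF v(1), of "fst c" "snd c"] by force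
        then show ?thesis
          using that profile_setD(1)[OF w, of "fst c" "snd c"] by (simp add: h_def G_def)
      qed
      have h_eq: "h = (\<Sum>c\<in>?C. h $ c *\<^sub>R shift b c)"
        unfolding h_def by (rule profile_diff_eq[OF b(1) v(1) w])
      \<comment> \<open>The derivative in direction \<open>h\<close> is \<open>?f d w\<close> up to
        the linearization error; the coordinates outside \<open>J\<close> are small masses, which
        contribute at most \<open>\<beta> * \<Gamma>\<close>.\<close>
      have lin: "\<bar>\<Sum>c\<in>J. h $ c * A c d\<bar> \<le> G d w + \<epsilon> * norm h + \<beta> * \<Gamma>" if d: "d \<in> J" for d
      proof -
        interpret L: bounded_linear "L d" using L by (rule has_derivative_bounded_linear)
        have "L d h = (\<Sum>c\<in>?C. h $ c * A c d)"
          by (subst h_eq) (simp add: L.sum L.scaleR A_def)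
        also have "\<dots> = (\<Sum>c\<in>?C - J. h $ c * A c d) + (\<Sum>c\<in>J. h $ c * A c d)"
          by (rule sum.subset_diff[OF JC finC])
        finally have split: "(\<Sum>c\<in>J. h $ c * A c d) = L d h - (\<Sum>c\<in>?C - J. h $ c * A c d)" by simp
        have "\<bar>\<Sum>c\<in>?C - J. h $ c * A c d\<bar> \<le> (\<Sum>c\<in>?C - J. G c w * \<beta>)"
          by (rule order_trans[OF sum_abs])
            (auto simp: abs_mult h_off intro!: sum_mono mult_mono \<beta> G0)
        also have "\<dots> \<le> \<beta> * \<Gamma>"
          unfolding \<Gamma>_def sum_distrib_left using G0 \<beta>0 by (subst mult.commute, intro sum_mono2) auto
        finally have "\<bar>\<Sum>c\<in>?C - J. h $ c * A c d\<bar> \<le> \<beta> * \<Gamma>" .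
        moreover have "\<bar>?f d w - L d h\<bar> \<le> \<epsilon> * norm h"
          using bspec[OF elim(1) d] by (simp add: h_def fv[OF d])
        ultimately show ?thesis
          unfolding split using d by (simp add: G_def)
      qed
      have G_\<Gamma>: "G d w \<le> \<Gamma>" if "d \<in> ?C" for d
        unfolding \<Gamma>_def using that G0 by (intro member_le_sum[of d ?C "\<lambda>c. G c w"]) auto
      \<comment> \<open>The linear system is solved with the inverse \<open>B\<close>, whose entries
        are bounded by \<open>\<beta>\<close>.\<close>
      have h_on: "\<bar>h $ e\<bar> \<le> n * (\<beta> * (\<Gamma> + \<epsilon> * norm h + \<beta> * \<Gamma>))" if e: "e \<in> J" for e
      proof -
        have "h $ e = (\<Sum>c\<in>J. if c = e then h $ c else 0)"
          using e by (simp add: finite_subset[OF JC finC])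
        also have "\<dots> = (\<Sum>c\<in>J. h $ c * (\<Sum>d\<in>J. A c d * B d e))"
          using e by (intro sum.cong refl) (simp add: B)
        also have "\<dots> = (\<Sum>d\<in>J. (\<Sum>c\<in>J. h $ c * A c d) * B d e)"
          unfolding sum_distrib_left sum_distrib_right by (subst sum.swap) (simp add: mult.assoc)
        finally have "\<bar>h $ e\<bar> \<le> (\<Sum>d\<in>J. \<bar>\<Sum>c\<in>J. h $ c * A c d\<bar> * \<bar>B d e\<bar>)"
          by (simp add: sum_abs[THEN order_trans] abs_mult)
        also have "\<dots> \<le> (\<Sum>d\<in>J. (\<Gamma> + \<epsilon> * norm h + \<beta> * \<Gamma>) * \<beta>)"
        proof (intro sum_mono mult_mono \<beta>)
          fix d assume d: "d \<in> J"
          show "\<bar>\<Sum>c\<in>J. h $ c * A c d\<bar> \<le> \<Gamma> + \<epsilon> * norm h + \<beta> * \<Gamma>"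
            using lin[OF d] G_\<Gamma>[of d] d JC by fastforce
          then show "0 \<le> \<Gamma> + \<epsilon> * norm h + \<beta> * \<Gamma>" by (rule order_trans[OF abs_ge_zero])
        qed auto
        finally show ?thesis by (simp add: n_def mult.commute)
      qed
      have "norm h \<le> (\<Sum>c\<in>?C. norm (h $ c *\<^sub>R (shift b c :: real^('a \<times> 'b))))"
        by (subst h_eq) (rule norm_sum)
      also have "\<dots> \<le> (\<Sum>c\<in>?C. \<bar>h $ c\<bar> * 2)"
        by (intro sum_mono) (simp add: mult_left_mono norm_shift)
      also have "\<dots> = 2 * ((\<Sum>c\<in>?C - J. \<bar>h $ c\<bar>) + (\<Sum>c\<in>J. \<bar>h $ c\<bar>))"
        unfolding sum.subset_diff[OF JC finC, of "\<lambda>c. \<bar>h $ c\<bar> * 2"] by (simp add: sum_distrib_left mult.commute distrib_left)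
      finally have 1: "norm h \<le> 2 * ((\<Sum>c\<in>?C - J. \<bar>h $ c\<bar>) + (\<Sum>c\<in>J. \<bar>h $ c\<bar>))" .
      have 2: "(\<Sum>c\<in>?C - J. \<bar>h $ c\<bar>) \<le> \<Gamma>"
        unfolding \<Gamma>_def using G0 by (simp add: h_off) (intro sum_mono2, auto)
      have "(\<Sum>c\<in>J. \<bar>h $ c\<bar>) \<le> (\<Sum>c\<in>J. n * (\<beta> * (\<Gamma> + \<epsilon> * norm h + \<beta> * \<Gamma>)))"
        by (intro sum_mono h_on)
      also have "\<dots> = n * (n * \<beta>) * (1 + \<beta>) * \<Gamma> + n * (n * \<beta>) * \<epsilon> * norm h"
        by (simp add: n_def algebra_simps)
      finally have 3: "(\<Sum>c\<in>J. \<bar>h $ c\<bar>) \<le> n * (n * \<beta>) * (1 + \<beta>) * \<Gamma> + n * (n * \<beta>) * \<epsilon> * norm h" .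
      \<comment> \<open>Since shifts have norm at most 2, the error term in the bound for
        \<open>norm h\<close> is at most \<open>norm h / 2\<close>. Absorbing it on the left doubles
        the constant 2 to 4.\<close>
      have "4 * (n * (n * \<beta>)) * \<epsilon> * norm h \<le> 1 * norm h"
        using \<epsilon>(2) by (intro mult_right_mono) auto
      then have "norm h \<le> 4 * (\<Gamma> + n * (n * \<beta>) * (1 + \<beta>) * \<Gamma>)"
        using 1 2 3 by (simp add: mult.assoc)
      also have "\<dots> = 4 * (1 + n * (n * \<beta>) * (1 + \<beta>)) * \<Gamma>" by (simp add: algebra_simps)
      also have "\<dots> \<le> 4 * (1 + n * (n * \<beta>) * (1 + \<beta>)) * ((\<Sum>c\<in>?C. K c) * ?R w)"
        using \<Gamma>_le nn0 \<beta>0 by (intro mult_left_mono) auto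
      finally show "dist w v \<le> 4 * (1 + n * (n * \<beta>) * (1 + \<beta>)) * (\<Sum>c\<in>?C. K c) * ?R w"
        by (simp add: dist_norm h_def mult.assoc)
    qed
  qed
  then show ?thesis by blast
qed

text \<open>The local bound leaves no other point of \<open>E\<close> near a point of
  \<open>E\<close>, and \<open>E\<close> is closed, so compactness makes it finite. Away from
  \<open>E\<close> the regret is locally bounded below while distances are bounded.\<close>

lemma regret_error_bound:
  assumes loc: "\<And>v. v \<in> profile_set Y \<Longrightarrow> regret Y u v = 0 \<Longrightarrow>
      \<exists>K. \<forall>\<^sub>F w in nhds v. w \<in> profile_set Y \<longrightarrow> dist w v \<le> K * regret Y u w"
    and E: "E = {v \<in> profile_set Y. regret Y u v = 0}"
  shows "finite E" "\<exists>K>0. \<forall>w\<in>profile_set Y. infdist w E \<le> K * regret Y u w"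
proof -
  let ?S = "profile_set Y" and ?R = "regret Y u"
  show "finite E"
  proof -
    have "finite (?S \<inter> E)"
    proof (rule finite_not_islimpt_in_compact[OF compact_profile_set])
      fix v assume v: "v \<in> ?S"
      show "\<not> v islimpt E"
      proof (cases "?R v = 0")
        case True
        then obtain K where "\<forall>\<^sub>F w in nhds v. w \<in> ?S \<longrightarrow> dist w v \<le> K * ?R w"
          using loc v by blast
        then have "\<forall>\<^sub>F w in at v. w \<notin> E"
          unfolding eventually_at_filter by eventually_elim (auto simp: E)
        then show ?thesis by (simp add: islimpt_iff_eventually)
      next
        case False
        have "closed E"
          unfolding E using compact_imp_closed[OF compact_profile_set]
          by (intro closed_Collect_conj closed_Collect_eq continuous_on_regret continuous_intros) auto
        moreover have "v \<notin> E" using False by (simp add: E)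
        ultimately show ?thesis unfolding closed_limpt by blast
      qed
    qed
    then show ?thesis by (simp add: E Int_absorb1 subset_iff)
  qed
  have "bounded ?S" using compact_profile_set by (rule compact_imp_bounded)
  then obtain M where M: "\<And>v w. v \<in> ?S \<Longrightarrow> w \<in> ?S \<Longrightarrow> dist v w \<le> M"
    unfolding bounded_two_points by blast
  show "\<exists>K>0. \<forall>w\<in>?S. infdist w E \<le> K * ?R w"
  proof (rule compact_local_bound[OF compact_profile_set regret_nonneg])
    fix v assume v: "v \<in> ?S"
    show "\<exists>K. \<forall>\<^sub>F w in nhds v. w \<in> ?S \<longrightarrow> infdist w E \<le> K * ?R w"
    proof (cases "?R v = 0")
      case True
      then obtain K where "\<forall>\<^sub>F w in nhds v. w \<in> ?S \<longrightarrow> dist w v \<le> K * ?R w"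
        using loc v by blast
      then have "\<forall>\<^sub>F w in nhds v. w \<in> ?S \<longrightarrow> infdist w E \<le> K * ?R w"
        by eventually_elim (use True v in \<open>auto simp: E intro: infdist_le2\<close>)
      then show ?thesis by blast
    next
      case False
      then have Rv: "?R v > 0" using regret_nonneg[of Y u v] by simp
      have M0: "0 \<le> M" using M[OF v v] by simp
      have "(?R \<longlongrightarrow> ?R v) (nhds v)"
        using continuous_on_regret[of UNIV Y u]
        by (simp add: continuous_on_eq_continuous_at isCont_def tendsto_at_iff_tendsto_nhds[symmetric])
      then have "\<forall>\<^sub>F w in nhds v. ?R v / 2 < ?R w"
        by (rule order_tendstoD(1)) (use Rv in simp)
      \<comment> \<open>The constant is a bound on the diameter divided by half the regret at
        \<open>v\<close>.\<close>
      then have "\<forall>\<^sub>F w in nhds v. w \<in> ?S \<longrightarrow> infdist w E \<le> (M * 2 / ?R v) * ?R w"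
      proof eventually_elim
        case (elim w)
        show ?case
        proof
          assume w: "w \<in> ?S"
          have "infdist w E \<le> M"
          \<comment> \<open>For empty \<open>E\<close> the distance \<open>infdist\<close> is 0 by
            convention; that \<open>E\<close> is nonempty is shown elsewhere.\<close>
          proof (cases "E = {}")
            case False
            then obtain p where "p \<in> E" by blast
            then show ?thesis using M[OF w, of p] by (intro infdist_le2[of p]) (auto simp: E)
          qed (simp add: infdist_def M0)
          also have "M \<le> (M * 2 / ?R v) * ?R w"
            using elim Rv M0 mult_left_mono[of "?R v / 2" "?R w" "M * 2 / ?R v"] by (simp add: field_simps)
          finally show "infdist w E \<le> (M * 2 / ?R v) * ?R w" .
        qed
      qed
      then show ?thesis by blast
    qed
  qed
qed

subsection \<open>Best-response dynamics\<close>

definition mass_vec ::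
  "('p \<Rightarrow> 'a set) \<Rightarrow> ('p \<Rightarrow> 'a) \<Rightarrow> ('p, 'a) point \<Rightarrow> real^('p::finite \<times> 'a::finite)" where
  "mass_vec Y b x = (\<chi> c. if snd c \<in> Y (fst c) then mass Y b x (fst c) (snd c) else 0)"

lemma mass_vec_nth: "mass_vec Y b x $ (i, a) = (if a \<in> Y i then mass Y b x i a else 0)"
  by (simp add: mass_vec_def)

lemma mass_vec_coords: "c \<in> coords Y b \<Longrightarrow> mass_vec Y b x $ c = x c"
  by (auto simp: coords_def mass_vec_def mass_def)

lemma mixed_ext_eq_expected: "mixed_ext Y b u x = expected Y u (mass_vec Y b x)"
  unfolding mixed_ext_def expected_def
  by (intro sum.cong refl arg_cong2[where f = times] prod.cong)
    (auto simp: mass_vec_nth action_profiles_def PiE_def)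

lemma mass_vec_in_profile_set:
  assumes b: "\<And>i. b i \<in> Y i" and x: "x \<in> strategy_space Y b"
  shows "mass_vec Y b x \<in> profile_set Y"
proof -
  have nn: "0 \<le> x (i, a)" if "a \<in> Y i - {b i}" for i a
    using x that by (force simp: strategy_space_def player_strategies_def component_def)
  have sum1: "(\<Sum>a\<in>Y i - {b i}. x (i, a)) \<le> 1" for i
    using x by (auto simp: strategy_space_def player_strategies_def component_def)
  have "0 \<le> mass_vec Y b x $ (i, a)" for i a
    using nn[of a i] sum1[of i] by (auto simp: mass_vec_nth mass_def)
  moreover have "(\<Sum>a\<in>Y i. mass_vec Y b x $ (i, a)) = 1" for i
    using sum_mass[of b i Y x, OF b] by (simp add: mass_vec_nth)
  ultimately show ?thesis by (auto simp: profile_set_def mass_vec_nth)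
qed

lemma mass_vec_surj:
  assumes b: "\<And>i. b i \<in> Y i" and v: "v \<in> profile_set Y"
  shows "\<exists>x\<in>strategy_space Y b. mass_vec Y b x = v"
proof -
  define x where "x = restrict (($) v) (coords Y b)"
  have x: "x (i, a) = v $ (i, a)" if "a \<in> Y i - {b i}" for i a
    using that by (simp add: x_def coords_def)
  have s: "v $ (i, b i) + (\<Sum>a\<in>Y i - {b i}. x (i, a)) = 1" for i
    using profile_setD(3)[OF v, of i] sum.remove[of "Y i" "b i" "\<lambda>a. v $ (i, a)"] b by (simp add: x)
  have "(\<Sum>a\<in>Y i - {b i}. x (i, a)) \<le> 1" for i
    using s[of i] profile_setD(1)[OF v, of i "b i"] by linarith
  then have "x \<in> strategy_space Y b"
    using profile_setD(1)[OF v]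
    by (auto simp: strategy_space_def player_strategies_def component_def x) (simp add: x_def)
  moreover have "mass_vec Y b x $ (i, a) = v $ (i, a)" for i a
    using s[of i] profile_setD(2)[OF v, of a i] x[of a i] by (auto simp: mass_vec_nth mass_def algebra_simps)
  then have "mass_vec Y b x = v" by (simp add: vec_eq_iff split_paired_all)
  ultimately show ?thesis by blast
qed

text \<open>The masses are the coordinate-free object; regularity conditions stated in different
  coordinate systems are compared through them.\<close>

lemma mass_vec_change_base:
  assumes b: "\<And>i. b i \<in> Y i" and b': "\<And>i. b' i \<in> Y i"
  shows "mass_vec Y b' (change_base Y b b' x) = mass_vec Y b x"
proof -
  have *: "change_base Y b b' x (i, a) = mass Y b x i a" if "a \<in> Y i - {b' i}" for i a
    using that by (simp add: change_base_def coords_def)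
  have "mass Y b' (change_base Y b b' x) i a = mass Y b x i a" if "a \<in> Y i" for i a
  proof (cases "a = b' i")
    case True
    have "mass Y b x i (b' i) + (\<Sum>a\<in>Y i - {b' i}. mass Y b x i a) = 1"
      using sum_mass[of b i Y x, OF b] sum.remove[of "Y i" "b' i" "mass Y b x i"] b' by simp
    then show ?thesis using True by (simp add: mass_def[of Y b'] *)
  qed (use that in \<open>simp add: mass_def[of Y b'] *\<close>)
  then show ?thesis by (simp add: vec_eq_iff split_paired_all mass_vec_nth)
qed

section \<open>First and second partial derivatives of the multilinear extension\<close>

lemma mass_vec_upd:
  assumes b: "\<And>i. b i \<in> Y i" and c: "c \<in> coords Y b"
  shows "mass_vec Y b (x(c := s)) = mass_vec Y b x + (s - x c) *\<^sub>R shift b c"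
proof -
  obtain i a where c_eq: "c = (i, a)" and a: "a \<in> Y i - {b i}" using c by (auto simp: coords_def)
  have sum: "(\<Sum>e\<in>Y j - {b j}. (x(c := s)) (j, e)) = (\<Sum>e\<in>Y j - {b j}. x (j, e)) + (if j = i then s - x c else 0)" for j
  proof -
    have "(\<Sum>e\<in>Y j - {b j}. (x(c := s)) (j, e)) =
        (\<Sum>e\<in>Y j - {b j}. x (j, e) + (if e = a then if j = i then s - x c else 0 else 0))"
      by (intro sum.cong) (auto simp: c_eq)
    then show ?thesis using a by (auto simp: sum.distrib)
  qed
  have "mass_vec Y b (x(c := s)) $ (j, e) = (mass_vec Y b x + (s - x c) *\<^sub>R shift b c) $ (j, e)" for j e
    using a b[of j] unfolding mass_vec_nth mass_def sum by (auto simp: c_eq shift_def axis_Pair_nth mass_vec_nth mass_def)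
  then show ?thesis by (simp add: vec_eq_iff split_paired_all)
qed

text \<open>Along a coordinate line the masses move along \<open>shift b c\<close>, where the
  expected potential is affine with the advantage as slope.\<close>

lemma partial_mixed_ext:
  assumes b: "\<And>i. b i \<in> Y i" and c: "c \<in> coords Y b"
  shows "partial x (mixed_ext Y b u) c = advantage Y b u c (mass_vec Y b x)"
proof -
  obtain i a where c_eq: "c = (i, a)" and a: "a \<in> Y i" using c by (auto simp: coords_def)
  have "mixed_ext Y b u (x(c := s)) = mixed_ext Y b u x + (s - x c) * advantage Y b u c (mass_vec Y b x)" for s
    using expected_shift[of a Y i "b i" u "mass_vec Y b x" "s - x c", OF a b]
    by (simp add: mixed_ext_eq_expected mass_vec_upd[OF b c[unfolded c_eq]] shift_def c_eq advantage_def)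
  then show ?thesis
    unfolding partial_def by (intro DERIV_imp_deriv) (auto intro!: derivative_eq_intros)
qed

text \<open>By the chain rule, a Hessian entry is the derivative of one advantage along the shift of
  another coordinate. This identifies the matrix in second-order non-degeneracy.\<close>

lemma partial2_mixed_ext:
  assumes b: "\<And>i. b i \<in> Y i" and c: "c \<in> coords Y b" and d: "d \<in> coords Y b"
    and L: "(advantage Y b u d has_derivative L) (at (mass_vec Y b x))"
  shows "partial2 x (mixed_ext Y b u) c d = L (shift b c)"
proof -
  interpret L: bounded_linear L using L by (rule has_derivative_bounded_linear)
  have "((\<lambda>s. mass_vec Y b x + (s - x c) *\<^sub>R shift b c) has_derivative (\<lambda>h. h *\<^sub>R shift b c)) (at (x c))"
    by (auto intro!: derivative_eq_intros)
  moreover have "(advantage Y b u d has_derivative L) (at (mass_vec Y b x + (x c - x c) *\<^sub>R shift b c))"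
    using L by simp
  ultimately have "((\<lambda>s. advantage Y b u d (mass_vec Y b x + (s - x c) *\<^sub>R shift b c)) has_derivative
      (\<lambda>h. L (h *\<^sub>R shift b c))) (at (x c))"
    by (rule has_derivative_compose)
  then have "((\<lambda>s. advantage Y b u d (mass_vec Y b x + (s - x c) *\<^sub>R shift b c)) has_real_derivative
      L (shift b c)) (at (x c))"
    unfolding has_field_derivative_def by (rule has_derivative_eq_rhs) (auto simp: L.scaleR)
  then show ?thesis
    unfolding partial2_def partial_mixed_ext[OF b d] unfolding partial_def mass_vec_upd[OF b c]
    by (rule DERIV_imp_deriv)
qed

section \<open>Best replies and equilibria in terms of pure payoffs\<close>

lemma mixed_ext_replace_component:
  assumes b: "\<And>i. b i \<in> Y i"
  shows "mixed_ext Y b u (replace_component x i f) =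
    (\<Sum>a\<in>Y i. (if a = b i then 1 - (\<Sum>e\<in>Y i - {b i}. f e) else f a) * payoff Y u (mass_vec Y b x) i a)"
proof -
  have "payoff Y u (mass_vec Y b (replace_component x i f)) i a = payoff Y u (mass_vec Y b x) i a" for a
    by (rule payoff_cong) (simp add: mass_vec_nth mass_def replace_component_def)
  then show ?thesis
    unfolding mixed_ext_eq_expected expected_eq[of Y u _ i]
    by (intro sum.cong) (auto simp: mass_vec_nth mass_def replace_component_def)
qed

lemma BR_mass_vec:
  assumes b: "\<And>i. b i \<in> Y i" and z: "z \<in> BR Y b u x"
  shows "mass_vec Y b z \<in> profile_set Y"
    and "a' \<in> Y i \<Longrightarrow> payoff Y u (mass_vec Y b x) i a' \<le>
      (\<Sum>a\<in>Y i. mass_vec Y b z $ (i, a) * payoff Y u (mass_vec Y b x) i a)"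
proof -
  have z': "z \<in> extensional (coords Y b)" "component Y b i z \<in> best_replies Y b u i x" for i
    using z by (auto simp: BR_def)
  then have "z \<in> strategy_space Y b"
    by (auto simp: strategy_space_def best_replies_def is_arg_max_def)
  then show "mass_vec Y b z \<in> profile_set Y" by (rule mass_vec_in_profile_set[OF b])
  assume a': "a' \<in> Y i"
  \<comment> \<open>The pure strategy \<open>a'\<close> as a competitor; for \<open>a' = b i\<close>
    it is the zero vector, because the base action has no coordinate.\<close>
  define g where "g = restrict (\<lambda>a. if a = a' then 1 else 0 :: real) (Y i - {b i})"
  have sum_g: "(\<Sum>e\<in>Y i - {b i}. g e) = (if a' = b i then 0 else 1)"
    using a' by (simp add: g_def)
  have "g \<in> player_strategies Y b i"
    unfolding player_strategies_def using sum_g by (auto simp: g_def)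
  then have "mixed_ext Y b u (replace_component x i g) \<le> mixed_ext Y b u (replace_component x i (component Y b i z))"
    using z'(2)[of i] by (auto simp: best_replies_def is_arg_max_def not_less)
  also have "mixed_ext Y b u (replace_component x i g) = (\<Sum>a\<in>Y i. if a = a' then payoff Y u (mass_vec Y b x) i a else 0)"
    unfolding mixed_ext_replace_component[OF b] sum_g by (intro sum.cong) (auto simp: g_def)
  also have "\<dots> = payoff Y u (mass_vec Y b x) i a'" using a' by simp
  also have "mixed_ext Y b u (replace_component x i (component Y b i z)) =
      (\<Sum>a\<in>Y i. mass_vec Y b z $ (i, a) * payoff Y u (mass_vec Y b x) i a)"
    unfolding mixed_ext_replace_component[OF b]
    by (intro sum.cong) (auto simp: mass_vec_nth mass_def component_def)
  finally show "payoff Y u (mass_vec Y b x) i a' \<le>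
      (\<Sum>a\<in>Y i. mass_vec Y b z $ (i, a) * payoff Y u (mass_vec Y b x) i a)" .
qed

lemma regret_zero_imp_NE:
  assumes b: "\<And>i. b i \<in> Y i" and x: "x \<in> strategy_space Y b" and r: "regret Y u (mass_vec Y b x) = 0"
  shows "x \<in> NE Y b u"
proof -
  let ?m = "mass_vec Y b x"
  have m: "?m \<in> profile_set Y" by (rule mass_vec_in_profile_set[OF b x])
  have comp: "component Y b i x \<in> player_strategies Y b i" and ext: "x \<in> extensional (coords Y b)" for i
    using x by (auto simp: strategy_space_def)
  have "component Y b i x \<in> best_replies Y b u i x" for i
  proof -
    define V where "V = (\<Sum>a\<in>Y i. ?m $ (i, a) * payoff Y u ?m i a)"
    have V: "mixed_ext Y b u (replace_component x i (component Y b i x)) = V"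
      unfolding mixed_ext_replace_component[OF b] V_def
      by (intro sum.cong) (auto simp: mass_vec_nth mass_def component_def)
    have le: "payoff Y u ?m i a' \<le> V" if "a' \<in> Y i" for a'
    proof -
      \<comment> \<open>The excess of \<open>a'\<close> over the current value is an average of
        terms each bounded by the regret, which is zero.\<close>
      have "payoff Y u ?m i a' - V = (\<Sum>a\<in>Y i. ?m $ (i, a)) * payoff Y u ?m i a' - V"
        by (simp add: profile_setD(3)[OF m])
      also have "\<dots> = (\<Sum>a\<in>Y i. ?m $ (i, a) * (payoff Y u ?m i a' - payoff Y u ?m i a))"
        by (simp add: V_def sum_distrib_right right_diff_distrib sum_subtractf)
      also have "\<dots> \<le> 0"
        using regret_ge[of _ Y i a' ?m u, OF _ that] r by (intro sum_nonpos) auto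
      finally show ?thesis by simp
    qed
    have "mixed_ext Y b u (replace_component x i g) \<le> V" if g: "g \<in> player_strategies Y b i" for g
    proof -
      let ?q = "\<lambda>a. if a = b i then 1 - (\<Sum>e\<in>Y i - {b i}. g e) else g a"
      have q: "0 \<le> ?q a" if "a \<in> Y i" for a
        using g that by (auto simp: player_strategies_def)
      have "(\<Sum>a\<in>Y i. ?q a) = ?q (b i) + (\<Sum>a\<in>Y i - {b i}. ?q a)"
        by (rule sum.remove) (use b in auto)
      also have "(\<Sum>a\<in>Y i - {b i}. ?q a) = (\<Sum>a\<in>Y i - {b i}. g a)"
        by (intro sum.cong) auto
      finally have q1: "(\<Sum>a\<in>Y i. ?q a) = 1" by simp
      have "mixed_ext Y b u (replace_component x i g) \<le> (\<Sum>a\<in>Y i. ?q a * V)"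
        unfolding mixed_ext_replace_component[OF b] by (intro sum_mono mult_left_mono le q)
      also have "\<dots> = V" unfolding sum_distrib_right[symmetric] q1 by simp
      finally show ?thesis .
    qed
    then show ?thesis
      using comp[of i] V by (auto simp: best_replies_def is_arg_max_def not_less)
  qed
  then show ?thesis using x ext by (simp add: NE_def BR_def)
qed

text \<open>The two non-degeneracy conditions come with base actions \<open>b1\<close> and
  \<open>b2\<close> that may differ; both are expressed in the coordinates of \<open>b2\<close>,
  where the local bound applies.\<close>

lemma regular_game_local_bound:
  assumes b: "\<And>i. b i \<in> Y i" and reg: "regular_game Y b u"
    and v: "v \<in> profile_set Y" "regret Y u v = 0"
  shows "\<exists>K. \<forall>\<^sub>F w in nhds v. w \<in> profile_set Y \<longrightarrow> dist w v \<le> K * regret Y u w"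
proof -
  obtain x where x: "x \<in> strategy_space Y b" "mass_vec Y b x = v"
    using mass_vec_surj[of b Y v, OF b v(1)] by blast
  then have "x \<in> NE Y b u"
    using v(2) by (intro regret_zero_imp_NE b) auto
  then have nondeg: "first_order_nondegenerate Y b u x" "second_order_nondegenerate Y b u x"
    using reg by (auto simp: regular_game_def)
  have supp_iff: "a \<in> supp Y b x i \<longleftrightarrow> a \<in> Y i \<and> 0 < v $ (i, a)" for i a
    by (auto simp: supp_def mass_vec_nth x(2)[symmetric])
  obtain b1 where b1: "\<And>i. b1 i \<in> supp Y b x i"
    and first: "\<And>i a. a \<in> Y i - supp Y b x i \<Longrightarrow> partial (change_base Y b b1 x) (mixed_ext Y b1 u) (i, a) \<noteq> 0"
    using nondeg(1) unfolding first_order_nondegenerate_def by blast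
  obtain b2 where b2: "\<And>i. b2 i \<in> supp Y b x i"
    and second: "invertible_matrix_on (SIGMA i:UNIV. supp Y b x i - {b2 i})
        (partial2 (change_base Y b b2 x) (mixed_ext Y b2 u))"
    using nondeg(2) unfolding second_order_nondegenerate_def by blast
  have b1Y: "b1 i \<in> Y i" and b2Y: "b2 i \<in> Y i" and b1p: "0 < v $ (i, b1 i)" and b2p: "0 < v $ (i, b2 i)" for i
    using b1 b2 supp_iff by blast+
  \<comment> \<open>Both base actions carry mass at a profile of regret zero, so neither can be
    better than the other, and advantages relative to them agree.\<close>
  have same: "payoff Y u v i (b1 i) = payoff Y u v i (b2 i)" for i
    using regret_ge[of "b1 i" Y i "b2 i" v u, OF b1Y b2Y] regret_ge[of "b2 i" Y i "b1 i" v u, OF b2Y b1Y]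
      b1p[of i] b2p[of i] v(2) by (auto simp: mult_le_0_iff)
  have adv: "advantage Y b2 u (i, a) v \<noteq> 0" if a: "a \<in> Y i" "v $ (i, a) = 0" for i a
  proof -
    have "a \<noteq> b1 i" using a(2) b1p[of i] by auto
    then have "(i, a) \<in> coords Y b1" using a(1) by (simp add: coords_def)
    moreover have "partial (change_base Y b b1 x) (mixed_ext Y b1 u) (i, a) \<noteq> 0"
      using a by (intro first) (simp add: supp_iff)
    ultimately have "advantage Y b1 u (i, a) v \<noteq> 0"
      using partial_mixed_ext[of b1 Y "(i, a)" "change_base Y b b1 x" u, OF b1Y]
        mass_vec_change_base[of b Y b1 x, OF b b1Y] x(2) by simp
    then show ?thesis by (simp add: advantage_def same)
  qed
  have "\<exists>L. (advantage Y b2 u d has_derivative L) (at v)" for d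
  proof -
    obtain L1 L2 where "((\<lambda>m. payoff Y u m (fst d) (snd d)) has_derivative L1) (at v)"
      "((\<lambda>m. payoff Y u m (fst d) (b2 (fst d))) has_derivative L2) (at v)"
      using payoff_has_derivative by blast
    then have "((\<lambda>m. payoff Y u m (fst d) (snd d) - payoff Y u m (fst d) (b2 (fst d))) has_derivative
        (\<lambda>h. L1 h - L2 h)) (at v)"
      by (rule has_derivative_diff)
    then show ?thesis unfolding advantage_def[abs_def] by blast
  qed
  then obtain L where L: "\<And>d. (advantage Y b2 u d has_derivative L d) (at v)" by metis
  define J where "J = {c \<in> coords Y b2. 0 < v $ c}"
  have J_eq: "(SIGMA i:UNIV. supp Y b x i - {b2 i}) = J"
    by (auto simp: J_def coords_def supp_iff)
  have p2: "partial2 (change_base Y b b2 x) (mixed_ext Y b2 u) c d = L d (shift b2 c)" if "c \<in> J" "d \<in> J" for c d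
  proof (rule partial2_mixed_ext[of b2 Y])
    show "(advantage Y b2 u d has_derivative L d) (at (mass_vec Y b2 (change_base Y b b2 x)))"
      using L mass_vec_change_base[of b Y b2 x, OF b b2Y] x(2) by simp
  qed (use that b2Y in \<open>auto simp: J_def\<close>)
  have "invertible_matrix_on J (\<lambda>c d. L d (shift b2 c))"
    using second unfolding J_eq invertible_matrix_on_def by (simp add: p2 cong: sum.cong ball_cong)
  then show ?thesis
    using v b2Y b2p adv L by (intro regret_lower_bound[where b = b2 and J = J and L = L]) (auto simp: J_def)
qed

section \<open>Speed and convergence of solutions\<close>

lemma absolutely_continuous_derivative_le_1:
  fixes f :: "real \<Rightarrow> real"
  assumes ac: "\<And>T. 0 \<le> T \<Longrightarrow> absolutely_continuous_on {0..T} f"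
    and ae: "AE t in lborel. 0 \<le> t \<longrightarrow> (\<exists>d. \<bar>d\<bar> \<le> 1 \<and> (f has_real_derivative d) (at t within {0..}))"
    and st: "0 \<le> s" "s \<le> t"
  shows "\<bar>f s - f t\<bar> \<le> t - s"
proof -
  \<comment> \<open>Both signs are needed: the identity plus or minus \<open>f\<close> has
    nonnegative derivative almost everywhere, which gives the two one-sided Lipschitz
    bounds.\<close>
  have "s + \<sigma> * f s \<le> t + \<sigma> * f t" if \<sigma>: "\<bar>\<sigma>\<bar> = 1" for \<sigma>
  proof (rule absolutely_continuous_nondecreasing[OF st(2), where f = "\<lambda>r. r + \<sigma> * f r"])
    have "absolutely_continuous_on {s..t} f"
      by (rule absolutely_continuous_on_subset[OF ac[of t]]) (use st in auto)
    then show "absolutely_continuous_on {s..t} (\<lambda>r. r + \<sigma> * f r)"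
    proof (rule absolutely_continuous_on_dist_le[where K = 1])
      fix x y :: real assume "x \<le> y"
      have "\<bar>\<sigma> * f x - \<sigma> * f y\<bar> = \<bar>f x - f y\<bar>"
        using \<sigma> by (simp add: right_diff_distrib[symmetric] abs_mult)
      moreover have "dist (x + \<sigma> * f x) (y + \<sigma> * f y) = \<bar>(x - y) + (\<sigma> * f x - \<sigma> * f y)\<bar>"
        by (simp add: dist_real_def algebra_simps)
      ultimately show "dist (x + \<sigma> * f x) (y + \<sigma> * f y) \<le> dist (f x) (f y) + 1 * (y - x)"
        using \<open>x \<le> y\<close> abs_triangle_ineq[of "x - y" "\<sigma> * f x - \<sigma> * f y"] by (simp add: dist_real_def)
    qed simp
    show "AE r in lborel. r \<in> {s..t} \<longrightarrow>
        (\<exists>d\<ge>0. ((\<lambda>r. r + \<sigma> * f r) has_real_derivative d) (at r within {s..t}))"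
      using ae
    proof eventually_elim
      case (elim r)
      show ?case
      proof
        assume r: "r \<in> {s..t}"
        then obtain d where d: "\<bar>d\<bar> \<le> 1" "(f has_real_derivative d) (at r within {0..})"
          using elim st by auto
        have "(f has_real_derivative d) (at r within {s..t})"
          using d(2) by (rule DERIV_subset) (use st in auto)
        then have "((\<lambda>r. r + \<sigma> * f r) has_real_derivative (1 + \<sigma> * d)) (at r within {s..t})"
          by (auto intro!: derivative_eq_intros)
        moreover have "\<bar>\<sigma> * d\<bar> \<le> 1" using d(1) \<sigma> by (simp add: abs_mult)
        then have "0 \<le> 1 + \<sigma> * d" by linarith
        ultimately show "\<exists>d\<ge>0. ((\<lambda>r. r + \<sigma> * f r) has_real_derivative d) (at r within {s..t})" by blast
      qed
    qed
  qed
  from this[of 1] this[of "-1"] show ?thesis by simp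
qed

text \<open>The abstract approach lemma is applied to the path of masses. The estimate holds along
  every solution, whatever its initial condition, so the exceptional null set of initial conditions
  can be taken empty.\<close>

lemma solution_converges_exponentially:
  fixes Y :: "'p::finite \<Rightarrow> 'a::finite set"
  assumes b: "\<And>i. b i \<in> Y i" and reg: "regular_game Y b u" and sol: "solution Y b u x0 x"
  shows "\<exists>c>0. \<exists>l>0. \<forall>t\<ge>0. distance_to Y b (x t) (NE Y b u) \<le> c * exp (- l * t)"
proof -
  let ?S = "profile_set Y"
  define E where "E = {v \<in> ?S. regret Y u v = 0}"
  define m where "m t = mass_vec Y b (x t)" for t
  have xS: "x t \<in> strategy_space Y b" if "0 \<le> t" for t
    using sol that by (simp add: solution_def)
  have mS: "m t \<in> ?S" if "0 \<le> t" for t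
    unfolding m_def by (rule mass_vec_in_profile_set[OF b xS[OF that]])
  have ae: "AE t in lborel. 0 \<le> t \<longrightarrow> (\<exists>z \<in> BR Y b u (x t). \<forall>c \<in> coords Y b.
      ((\<lambda>s. x s c) has_real_derivative (z c - x t c)) (at t within {0..}))"
    using sol by (simp add: solution_def)
  have x_Lip: "\<bar>x s c - x t c\<bar> \<le> t - s" if c: "c \<in> coords Y b" and st: "0 \<le> s" "s \<le> t" for c s t
  proof (rule absolutely_continuous_derivative_le_1[where f = "\<lambda>s. x s c"])
    show "absolutely_continuous_on {0..T} (\<lambda>s. x s c)" if "0 \<le> T" for T
      using sol that c by (simp add: solution_def)
    show "AE t in lborel. 0 \<le> t \<longrightarrow> (\<exists>d. \<bar>d\<bar> \<le> 1 \<and> ((\<lambda>s. x s c) has_real_derivative d) (at t within {0..}))"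
      using ae
    proof eventually_elim
      case (elim t)
      show ?case
      proof
        assume t: "0 \<le> t"
        then obtain z where z: "z \<in> BR Y b u (x t)"
          "((\<lambda>s. x s c) has_real_derivative (z c - x t c)) (at t within {0..})"
          using elim c by blast
        have zS: "mass_vec Y b z \<in> ?S" by (rule BR_mass_vec(1)[OF b z(1)])
        have "0 \<le> z c" "z c \<le> 1" "0 \<le> x t c" "x t c \<le> 1"
          using profile_setD(1,4)[OF zS, of "fst c" "snd c"] profile_setD(1,4)[OF mS[OF t], of "fst c" "snd c"] c
          by (auto simp: mass_vec_coords m_def)
        then show "\<exists>d. \<bar>d\<bar> \<le> 1 \<and> ((\<lambda>s. x s c) has_real_derivative d) (at t within {0..})"
          using z(2) by (intro exI[of _ "z c - x t c"]) auto
      qed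
    qed
  qed (use st in auto)
  \<comment> \<open>Each coordinate moves at speed at most 1 and each shift has norm at most 2; the
    summand 1 keeps \<open>D\<close> positive when there are no coordinates.\<close>
  define D where "D = real (card (coords Y b)) * 2 + 1"
  have D: "D > 0" by (simp add: D_def add_nonneg_pos)
  have m_Lip': "dist (m s) (m t) \<le> D * (t - s)" if st: "0 \<le> s" "s \<le> t" for s t
  proof -
    have "m s - m t = (\<Sum>c\<in>coords Y b. (x s c - x t c) *\<^sub>R shift b c)"
      using profile_diff_eq[of b Y, OF b mS mS, of t s] st by (simp add: m_def mass_vec_coords)
    then have "dist (m s) (m t) \<le> (\<Sum>c\<in>coords Y b. \<bar>x s c - x t c\<bar> * norm (shift b c))"
      by (simp add: dist_norm sum_norm_le)
    also have "\<dots> \<le> (\<Sum>c\<in>coords Y b. (t - s) * 2)"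
      using st by (intro sum_mono mult_mono x_Lip norm_shift) auto
    also have "\<dots> \<le> D * (t - s)"
      using st by (simp add: D_def algebra_simps)
    finally show ?thesis .
  qed
  have m_Lip: "dist (m s) (m t) \<le> D * \<bar>s - t\<bar>" if "0 \<le> s" "0 \<le> t" for s t
    using m_Lip'[of s t] m_Lip'[of t s] that by (cases "s \<le> t") (auto simp: dist_commute)
  have finE: "finite E" and "\<exists>K>0. \<forall>w\<in>?S. infdist w E \<le> K * regret Y u w"
    by (rule regret_error_bound[OF regular_game_local_bound[OF b reg] E_def]; assumption)+
  then obtain K where K: "K > 0" "\<And>w. w \<in> ?S \<Longrightarrow> infdist w E \<le> K * regret Y u w" by blast
  have E0: "E \<noteq> {}" using regret_zero_exists[of b Y u, OF b] by (auto simp: E_def)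
  obtain L where L: "L > 0" "\<And>v w. v \<in> ?S \<Longrightarrow> w \<in> ?S \<Longrightarrow> \<bar>expected Y u v - expected Y u w\<bar> \<le> L * dist v w"
    using expected_Lipschitz by blast
  \<comment> \<open>\<open>K\<close> turns distance into regret, and the square of the number of
    actions turns regret into growth of the potential.\<close>
  define k where "k = 1 / (K * (CARD('a))\<^sup>2)"
  have k: "k > 0" using K by (simp add: k_def)
  have ae': "AE t in lborel. 0 \<le> t \<longrightarrow> (\<exists>d. k * infdist (m t) E \<le> d \<and>
      ((\<lambda>s. expected Y u (m s)) has_real_derivative d) (at t within {0..}))"
    using ae
  proof eventually_elim
    case (elim t)
    show ?case
    proof
      assume t: "0 \<le> t"
      then obtain z where z: "z \<in> BR Y b u (x t)"
        "\<And>c. c \<in> coords Y b \<Longrightarrow> ((\<lambda>s. x s c) has_real_derivative (z c - x t c)) (at t within {0..})"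
        using elim by blast
      define q where "q = mass_vec Y b z"
      have "((\<lambda>s. m s $ (i, a)) has_real_derivative (q $ (i, a) - m t $ (i, a))) (at t within {0..})" for i a
      proof (cases "a \<in> Y i")
        case True
        show ?thesis
        proof (cases "a = b i")
          case base: True
          \<comment> \<open>The mass of the base action is not a coordinate of the solution; its
            derivative comes from those of the other masses.\<close>
          have "((\<lambda>s. 1 - (\<Sum>a\<in>Y i - {b i}. x s (i, a))) has_real_derivative
              0 - (\<Sum>a\<in>Y i - {b i}. z (i, a) - x t (i, a))) (at t within {0..})"
            by (intro DERIV_diff DERIV_sum DERIV_const z(2)) (auto simp: coords_def)
          then show ?thesis
            using base True by (simp add: m_def q_def mass_vec_nth mass_def sum_subtractf)
        next
          case False
          then show ?thesis
            using True z(2)[of "(i, a)"] by (simp add: m_def q_def mass_vec_nth mass_def coords_def)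
        qed
      qed (simp add: m_def q_def mass_vec_nth)
      then have "((\<lambda>s. m s $ c) has_real_derivative (q $ c - m t $ c)) (at t within {0..})" for c
        by (cases c) simp
      from expected_has_derivative_along[where Y = Y and u = u, OF this]
      have der: "((\<lambda>s. expected Y u (m s)) has_real_derivative
          (\<Sum>i\<in>UNIV. \<Sum>a\<in>Y i. (q $ (i, a) - m t $ (i, a)) * payoff Y u (m t) i a)) (at t within {0..})" .
      have "infdist (m t) E \<le> K * regret Y u (m t)" by (rule K(2)[OF mS[OF t]])
      also have "\<dots> \<le> K * ((CARD('a))\<^sup>2 * (\<Sum>i\<in>UNIV. \<Sum>a\<in>Y i. (q $ (i, a) - m t $ (i, a)) * payoff Y u (m t) i a))"
        using K(1) regret_le_gain[of "m t" Y u q, OF mS[OF t]] BR_mass_vec(2)[OF b z(1)]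
        by (intro mult_left_mono) (auto simp: m_def q_def)
      finally have "k * infdist (m t) E \<le> (\<Sum>i\<in>UNIV. \<Sum>a\<in>Y i. (q $ (i, a) - m t $ (i, a)) * payoff Y u (m t) i a)"
        using K(1) by (simp add: k_def field_simps)
      then show "\<exists>d. k * infdist (m t) E \<le> d \<and>
          ((\<lambda>s. expected Y u (m s)) has_real_derivative d) (at t within {0..})"
        using der by blast
    qed
  qed
  obtain p where p: "p \<in> ?S" "\<And>w. w \<in> ?S \<Longrightarrow> expected Y u w \<le> expected Y u p"
    using continuous_attains_sup[OF compact_profile_set _ continuous_on_expected] mS[of 0] by blast
  have "\<exists>c>0. \<exists>l>0. \<forall>t\<ge>0. infdist (m t) E \<le> c * exp (- l * t)"
    by (rule exponential_approach[OF finE E0 _ mS L D m_Lip k ae' p(2)[OF mS]]) (auto simp: E_def)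
  \<comment> \<open>The nearest profile in \<open>E\<close> lifts to an equilibrium, and the
    coordinates form part of the mass vector, so the distance in coordinates is no larger.\<close>
  moreover have "distance_to Y b (x t) (NE Y b u) \<le> infdist (m t) E" for t
  proof -
    obtain v where v: "v \<in> E" "infdist (m t) E = dist (m t) v"
      using infdist_attains_inf[OF finite_imp_closed[OF finE] E0] by blast
    obtain x' where x': "x' \<in> strategy_space Y b" "mass_vec Y b x' = v"
      using mass_vec_surj[of b Y v, OF b] v(1) by (auto simp: E_def)
    have "x' \<in> NE Y b u"
      using x' v(1) by (intro regret_zero_imp_NE b) (auto simp: E_def)
    then have "distance_to Y b (x t) (NE Y b u) \<le> L2_set (\<lambda>c. x t c - x' c) (coords Y b)"
      unfolding distance_to_def by (intro cINF_lower) (auto intro!: bdd_belowI[of _ 0] L2_set_nonneg)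
    also have "\<dots> = L2_set (\<lambda>c. norm ((m t - v) $ c)) (coords Y b)"
      unfolding L2_set_def by (simp add: m_def x'(2)[symmetric] mass_vec_coords)
    also have "\<dots> \<le> L2_set (\<lambda>c. norm ((m t - v) $ c)) UNIV"
      unfolding L2_set_def by (intro real_sqrt_le_mono sum_mono2) auto
    also have "\<dots> = infdist (m t) E" by (simp add: v(2) dist_norm norm_vec_def)
    finally show ?thesis .
  qed
  ultimately show ?thesis by (meson order_trans)
qed

theorem theorem1p4:
  fixes Y :: "'p::finite \<Rightarrow> 'a::finite set"
    and b :: "'p \<Rightarrow> 'a"
    and util :: "'p \<Rightarrow> ('p \<Rightarrow> 'a) \<Rightarrow> real"
    and w :: "'p \<Rightarrow> real"
    and u :: "('p \<Rightarrow> 'a) \<Rightarrow> real"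
  assumes "CARD('p) \<ge> 2"
    and "\<And>i. b i \<in> Y i"
    and "weighted_potential Y util w u"
    and "regular_game Y b u"
  shows "AE x0 in (\<Pi>\<^sub>M c\<in>coords Y b. lborel). x0 \<in> strategy_space Y b \<longrightarrow>
    (\<forall>x. solution Y b u x0 x \<longrightarrow>
      (\<exists>c>0. \<exists>l>0. \<forall>t\<ge>0. distance_to Y b (x t) (NE Y b u) \<le> c * exp (- l * t)))"
  using solution_converges_exponentially[of b Y u, OF assms(2,4)] by (intro AE_I2) blast

end
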